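(* Let $\tau$ be an infinite cardinal number and let $X$ be a space. Then the following conditions are equivalent: (a) $X$ is normal and $\tau$-expandable. (b) If $\Phi:X\to \mathscr{C}'_{\mathbf c}(\mathbb{J}(\tau))$ is l.s.c., $\theta:X\to \mathscr{C}(\mathbb{J}(\tau))$ is u.s.c. and $\theta\leqslant\Phi$, then there exists a continuous mapping $\varphi:X\to \mathscr{C}_{\mathbf c}(\mathbb{J}(\tau))$ such that $\theta\leqslant\varphi\leqslant \Phi$.
   Context: All spaces are infinite Hausdorff topological spaces. For a set $Y$, $2^Y$ denotes the family of all nonempty subsets of $Y$. For a space $Y$: $\mathscr{C}(Y)$ is the family of all nonempty compact subsets of $Y$; $\mathscr{C}_{\mathbf c}(Y)$ is the family of connected members of $\mathscr{C}(Y)$; for connected $Y$, $\mathscr{C}'_{\mathbf c}(Y)=\mathscr{C}_{\mathbf c}(Y)\cup\{Y\}$. A mapping $\Phi:X\to 2^Y$ is l.s.c. (lower semi-continuous) if $\Phi^{-1}(U)=\{x\in X:\Phi(x)\cap U\neq\varnothing\}$ is open in $X$ for every open $U\subseteq Y$; it is u.s.c. (upper semi-continuous) if $\Phi^{-1}(F)$ is closed in $X$ for every closed $F\subseteq Y$; it is continuous if it is both l.s.c. and u.s.c. For $\theta,\Phi:X\to 2^Y$, $\theta\leqslant\Phi$ means $\theta(x)\subseteq\Phi(x)$ for all $x\in X$. A space $X$ is $\tau$-expandable if every locally finite family $\mathscr{F}$ of closed subsets of $X$ with $|\mathscr{F}|\leq\tau$ admits a locally finite family $\{U_F:F\in\mathscr{F}\}$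 of open subsets of $X$ such that $F\subseteq U_F$ for each $F\in\mathscr{F}$. For a set $\mathscr{A}$, the metrizable hedgehog $\mathbb{J}(\mathscr{A})$ is the set $\{0\}\cup (0,1]\times\mathscr{A}$ with the metric $d(0,\langle s,\alpha\rangle)=s$, $d(\langle s,\alpha\rangle,\langle t,\beta\rangle)=|s-t|$ if $\alpha=\beta$, and $=s+t$ if $\alpha\neq\beta$. $\mathbb{J}(\tau)$ is $\mathbb{J}(\mathscr{A})$ for a set $\mathscr{A}$ of cardinality $\tau$; it is connected. *)

theory Defs
  imports "HOL-Analysis.Analysis"
begin

unbundle cardinal_syntax

section \<open>Families of compact sets\<close>

definition compact_sets :: "'a topology \<Rightarrow> 'a set set" where
  "compact_sets Y = {K. K \<noteq> {} \<and> compactin Y K}"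

definition compact_connected_sets :: "'a topology \<Rightarrow> 'a set set" where
  "compact_connected_sets Y = {K \<in> compact_sets Y. connectedin Y K}"

text \<open>Intended for connected \<open>Y\<close>; the whole space is admitted even when it is not compact.\<close>

definition compact_connected_sets' :: "'a topology \<Rightarrow> 'a set set" where
  "compact_connected_sets' Y = compact_connected_sets Y \<union> {topspace Y}"

section \<open>Set-valued mappings\<close>

definition lsc_map :: "'a topology \<Rightarrow> 'b topology \<Rightarrow> ('a \<Rightarrow> 'b set) \<Rightarrow> bool" where
  "lsc_map X Y \<Phi> \<longleftrightarrow> (\<forall>U. openin Y U \<longrightarrow> openin X {x \<in> topspace X. \<Phi> x \<inter> U \<noteq> {}})"

definition usc_map :: "'a topology \<Rightarrow> 'b topology \<Rightarrow> ('a \<Rightarrow> 'b set) \<Rightarrow> bool" where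
  "usc_map X Y \<Phi> \<longleftrightarrow> (\<forall>F. closedin Y F \<longrightarrow> closedin X {x \<in> topspace X. \<Phi> x \<inter> F \<noteq> {}})"

definition continuous_set_map :: "'a topology \<Rightarrow> 'b topology \<Rightarrow> ('a \<Rightarrow> 'b set) \<Rightarrow> bool" where
  "continuous_set_map X Y \<Phi> \<longleftrightarrow> lsc_map X Y \<Phi> \<and> usc_map X Y \<Phi>"

definition selection_le :: "'a topology \<Rightarrow> ('a \<Rightarrow> 'b set) \<Rightarrow> ('a \<Rightarrow> 'b set) \<Rightarrow> bool" where
  "selection_le X \<theta> \<Phi> \<longleftrightarrow> (\<forall>x \<in> topspace X. \<theta> x \<subseteq> \<Phi> x)"

section \<open>Expandability\<close>

text \<open>
  The expansion is locally finite as an indexed family: each point has a neighbourhood meeting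
  \<open>U F\<close> for only finitely many indices \<open>F\<close>. Requiring this only of the set of values would
  make the notion trivial, because \<open>U F = topspace X\<close> for all \<open>F\<close> would be allowed.
\<close>

definition locally_finite_family :: "'a topology \<Rightarrow> 'i set \<Rightarrow> ('i \<Rightarrow> 'a set) \<Rightarrow> bool" where
  "locally_finite_family X I U \<longleftrightarrow>
     (\<forall>i \<in> I. U i \<subseteq> topspace X) \<and>
     (\<forall>x \<in> topspace X. \<exists>V. openin X V \<and> x \<in> V \<and> finite {i \<in> I. U i \<inter> V \<noteq> {}})"

definition expandable :: "'k rel \<Rightarrow> 'a topology \<Rightarrow> bool" where
  "expandable \<tau> X \<longleftrightarrow>
     (\<forall>\<F>. (\<forall>F \<in> \<F>. closedin X F) \<and> locally_finite_in X \<F> \<and> |\<F>| \<le>o \<tau> \<longrightarrow>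
        (\<exists>U. (\<forall>F \<in> \<F>. openin X (U F) \<and> F \<subseteq> U F) \<and> locally_finite_family X \<F> U))"

section \<open>The metrizable hedgehog\<close>

datatype 'i hedgehog_point = Origin | Spine real 'i

definition hedgehog_points :: "'i set \<Rightarrow> 'i hedgehog_point set" where
  "hedgehog_points A = insert Origin {Spine s \<alpha> | s \<alpha>. 0 < s \<and> s \<le> 1 \<and> \<alpha> \<in> A}"

text \<open>
  All parameters are positive on \<open>hedgehog_points\<close>. The absolute values there are redundant;
  they make the function nonnegative on the whole type, as \<open>Metric_space\<close> requires.
\<close>

fun hedgehog_dist :: "'i hedgehog_point \<Rightarrow> 'i hedgehog_point \<Rightarrow> real" where
  "hedgehog_dist Origin Origin = 0"
| "hedgehog_dist Origin (Spine s \<alpha>) = \<bar>s\<bar>"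
| "hedgehog_dist (Spine s \<alpha>) Origin = \<bar>s\<bar>"
| "hedgehog_dist (Spine s \<alpha>) (Spine t \<beta>) = (if \<alpha> = \<beta> then \<bar>s - t\<bar> else \<bar>s\<bar> + \<bar>t\<bar>)"

lemma Metric_space_hedgehog: "Metric_space (hedgehog_points A) hedgehog_dist"
proof
  fix x y z :: "'a hedgehog_point"
  show "0 \<le> hedgehog_dist x y"
    by (cases x; cases y) auto
  show "hedgehog_dist x y = hedgehog_dist y x"
    by (cases x; cases y) auto
  show "hedgehog_dist x y = 0 \<longleftrightarrow> x = y" if "x \<in> hedgehog_points A" "y \<in> hedgehog_points A"
    using that by (cases x; cases y) (auto simp: hedgehog_points_def)
  show "hedgehog_dist x z \<le> hedgehog_dist x y + hedgehog_dist y z"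
    by (cases x; cases y; cases z) auto
qed

definition hedgehog :: "'i set \<Rightarrow> 'i hedgehog_point topology" where
  "hedgehog A = Metric_space.mtopology (hedgehog_points A) hedgehog_dist"

lemma topspace_hedgehog: "topspace (hedgehog A) = hedgehog_points A"
  by (simp add: hedgehog_def Metric_space.topspace_mtopology[OF Metric_space_hedgehog])

end

theory Submission
  imports Defs
begin

text \<open>
  Given \<open>\<theta>\<close> and \<open>\<Phi>\<close>, a Katetov-Tong insertion on the distance to the origin gives a continuous
  selection \<open>e\<close> of \<open>\<Phi>\<close> such that \<open>e x\<close> lies between the origin and every point of \<open>\<theta> x\<close>. From the
  root \<open>e x\<close> a branch grows towards the tip of each spine \<open>\<beta>\<close>, far enough to reach the points of
  \<open>\<theta> x\<close> and not beyond \<open>\<Phi> x\<close>; its length is obtained from a second insertion, now on the signed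
  coordinate along \<open>\<beta>\<close>. The union of the branches is always connected. It is compact and depends
  upper semi-continuously on \<open>x\<close> once, for every \<open>\<epsilon> > 0\<close>, the sets where the branches are longer
  than \<open>\<epsilon>\<close> form a locally finite family. The sets where \<open>\<theta>\<close> climbs higher than \<open>\<epsilon>\<close> on a spine
  are closed and locally finite, so expandability provides lower semi-continuous bounds for the
  lengths which enforce this.

  Conversely, let \<open>S \<subseteq> U\<close> with \<open>S\<close> closed and \<open>U\<close> open. On a single spine, take \<open>\<Phi>\<close> to be \<open>[0, 1]\<close>
  on \<open>U\<close> and \<open>{0}\<close> elsewhere, and \<open>\<theta>\<close> to be \<open>{0, 1}\<close> on \<open>S\<close> and \<open>{0}\<close> elsewhere: the set where a
  selection rises above \<open>1/2\<close> has its closure in \<open>U\<close>. If \<open>\<theta> x\<close> consists of the origin and the tips of the spines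
  indexed by those members of a locally finite closed family that contain \<open>x\<close>, then the sets where
  a selection rises above \<open>1/2\<close> expand the family.
\<close>

section \<open>Semicontinuous real functions\<close>

definition lower_semicontinuous :: "'a topology \<Rightarrow> ('a \<Rightarrow> real) \<Rightarrow> bool" where
  "lower_semicontinuous X f \<longleftrightarrow> (\<forall>c. openin X {x \<in> topspace X. c < f x})"

definition upper_semicontinuous :: "'a topology \<Rightarrow> ('a \<Rightarrow> real) \<Rightarrow> bool" where
  "upper_semicontinuous X f \<longleftrightarrow> (\<forall>c. openin X {x \<in> topspace X. f x < c})"

lemma upper_semicontinuous_uminus:
  "upper_semicontinuous X (\<lambda>x. - f x) \<longleftrightarrow> lower_semicontinuous X f"
proof -
  have "(\<forall>c. openin X {x \<in> topspace X. - f x < c}) \<longleftrightarrow> (\<forall>c. openin X {x \<in> topspace X. - f x < - c})"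
    by (metis minus_minus)
  then show ?thesis
    by (simp add: upper_semicontinuous_def lower_semicontinuous_def)
qed

lemma lower_semicontinuous_uminus:
  "lower_semicontinuous X (\<lambda>x. - f x) \<longleftrightarrow> upper_semicontinuous X f"
  using upper_semicontinuous_uminus[of X "\<lambda>x. - f x"] by simp

lemma continuous_map_imp_lower_semicontinuous:
  "continuous_map X euclideanreal f \<Longrightarrow> lower_semicontinuous X f"
  by (simp add: continuous_map_upper_lower_semicontinuous_lt lower_semicontinuous_def)

lemma continuous_map_imp_upper_semicontinuous:
  "continuous_map X euclideanreal f \<Longrightarrow> upper_semicontinuous X f"
  by (simp add: continuous_map_upper_lower_semicontinuous_lt upper_semicontinuous_def)

lemma lower_semicontinuous_add:
  assumes "lower_semicontinuous X f" "lower_semicontinuous X g"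
  shows "lower_semicontinuous X (\<lambda>x. f x + g x)"
  unfolding lower_semicontinuous_def
proof
  fix c
  have "{x \<in> topspace X. c < f x + g x}
      = (\<Union>q. {x \<in> topspace X. q < f x} \<inter> {x \<in> topspace X. c - q < g x})"
  proof (intro equalityI subsetI)
    fix x assume x: "x \<in> {x \<in> topspace X. c < f x + g x}"
    then obtain q where "c - g x < q" "q < f x"
      using dense[of "c - g x" "f x"] by auto
    with x show "x \<in> (\<Union>q. {x \<in> topspace X. q < f x} \<inter> {x \<in> topspace X. c - q < g x})"
      by (auto intro!: exI[of _ q])
  qed auto
  also have "openin X \<dots>"
    using assms by (auto simp: lower_semicontinuous_def)
  finally show "openin X {x \<in> topspace X. c < f x + g x}" .
qed

lemma lower_semicontinuous_min:
  assumes "lower_semicontinuous X f" "lower_semicontinuous X g"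
  shows "lower_semicontinuous X (\<lambda>x. min (f x) (g x))"
proof -
  have "{x \<in> topspace X. c < min (f x) (g x)}
      = {x \<in> topspace X. c < f x} \<inter> {x \<in> topspace X. c < g x}" for c
    by auto
  then show ?thesis
    using assms by (auto simp: lower_semicontinuous_def)
qed

lemma upper_semicontinuous_max:
  assumes "upper_semicontinuous X f" "upper_semicontinuous X g"
  shows "upper_semicontinuous X (\<lambda>x. max (f x) (g x))"
proof -
  have "{x \<in> topspace X. max (f x) (g x) < c}
      = {x \<in> topspace X. f x < c} \<inter> {x \<in> topspace X. g x < c}" for c
    by auto
  then show ?thesis
    using assms by (auto simp: upper_semicontinuous_def)
qed

lemma closedin_upper_semicontinuous:
  assumes "upper_semicontinuous X f"
  shows "closedin X {x \<in> topspace X. c \<le> f x}"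
proof -
  have "topspace X - {x \<in> topspace X. c \<le> f x} = {x \<in> topspace X. f x < c}"
    by auto
  then show ?thesis
    using assms by (auto simp: closedin_def upper_semicontinuous_def)
qed

text \<open>
  One step of the construction: a Urysohn function for \<open>{f - S \<ge> 2/3 r}\<close> inside
  \<open>{g - S > 1/3 r}\<close> reduces the gap from \<open>r\<close> to \<open>2/3 r\<close>, as in the proof of Tietze's theorem.
\<close>

lemma insertion_step:
  assumes X: "normal_space X" and f: "upper_semicontinuous X f" and g: "lower_semicontinuous X g"
    and fg: "\<And>x. x \<in> topspace X \<Longrightarrow> f x \<le> g x"
    and S: "continuous_map X euclideanreal S" and r: "0 < r"
    and fS: "\<And>x. x \<in> topspace X \<Longrightarrow> f x \<le> S x + r"
    and Sg: "\<And>x. x \<in> topspace X \<Longrightarrow> S x \<le> g x"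
  obtains S' where "continuous_map X euclideanreal S'"
    "\<And>x. x \<in> topspace X \<Longrightarrow> f x \<le> S' x + 2/3 * r"
    "\<And>x. x \<in> topspace X \<Longrightarrow> S' x \<le> g x"
    "\<And>x. x \<in> topspace X \<Longrightarrow> \<bar>S' x - S x\<bar> \<le> 1/3 * r"
proof -
  have lS: "lower_semicontinuous X S" and lS': "lower_semicontinuous X (\<lambda>x. - S x)"
    using S by (auto intro!: continuous_map_imp_lower_semicontinuous continuous_map_minus)
  \<comment> \<open>Off \<open>C\<close> the gap is already below \<open>2/3 * r\<close>; off
    \<open>D\<close> there is room to raise \<open>S\<close> by \<open>1/3 * r\<close> without
    crossing \<open>g\<close>.\<close>
  define C where "C = {x \<in> topspace X. 2/3 * r \<le> f x - S x}"
  define D where "D = topspace X - {x \<in> topspace X. 1/3 * r < g x + - S x}"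
  have "upper_semicontinuous X (\<lambda>x. - (- f x + S x))"
    unfolding upper_semicontinuous_uminus
    by (intro lower_semicontinuous_add lS) (simp add: f lower_semicontinuous_uminus)
  then have C: "closedin X C"
    unfolding C_def using closedin_upper_semicontinuous by fastforce
  have "lower_semicontinuous X (\<lambda>x. g x + - S x)"
    by (intro lower_semicontinuous_add lS' g)
  then have "openin X {x \<in> topspace X. 1/3 * r < g x + - S x}"
    unfolding lower_semicontinuous_def by blast
  then have D: "closedin X D"
    unfolding D_def by (intro closedin_diff closedin_topspace)
  \<comment> \<open>On \<open>C\<close> we have \<open>g - S \<ge> f - S \<ge> 2/3 * r\<close>,
    which exceeds \<open>1/3 * r\<close>.\<close>
  have "disjnt D C"
    using r by (auto simp: disjnt_iff C_def D_def dest!: fg)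
  then obtain u where u: "continuous_map X (top_of_set {0..1::real}) u"
      and u0: "u ` D \<subseteq> {0}" and u1: "u ` C \<subseteq> {1}"
    using Urysohn_lemma[OF X D C, of 0 1] by auto
  have cu: "continuous_map X euclideanreal u" and u01: "\<And>x. x \<in> topspace X \<Longrightarrow> 0 \<le> u x \<and> u x \<le> 1"
    using u by (auto simp: continuous_map_in_subtopology)
  define S' where "S' = (\<lambda>x. S x + 1/3 * r * u x)"
  show thesis
  proof
    show "continuous_map X euclideanreal S'"
      unfolding S'_def by (intro continuous_intros S cu) auto
  next
    fix x assume x: "x \<in> topspace X"
    have ur: "0 \<le> r * u x" "r * u x \<le> r"
      using u01[OF x] r by (auto simp: mult_left_le)
    show "f x \<le> S' x + 2/3 * r"
    proof (cases "x \<in> C")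
      case True
      then show ?thesis
        using u1 fS[OF x] by (force simp: S'_def)
    next
      case False
      then show ?thesis
        using x ur by (auto simp: C_def S'_def)
    qed
    show "S' x \<le> g x"
    proof (cases "x \<in> D")
      case True
      then show ?thesis
        using u0 Sg[OF x] by (force simp: S'_def)
    next
      case False
      then show ?thesis
        using x ur by (auto simp: D_def S'_def)
    qed
    show "\<bar>S' x - S x\<bar> \<le> 1/3 * r"
      using ur by (simp add: S'_def)
  qed
qed

text \<open>Iterating \<open>insertion_step\<close> shrinks the gap geometrically, so the
  approximations converge uniformly and both inequalities pass to the limit. The bounds
  \<open>a\<close> and \<open>b\<close> supply a starting function with a finite gap.\<close>

lemma Katetov_Tong_insertion:
  assumes X: "normal_space X" and f: "upper_semicontinuous X f" and g: "lower_semicontinuous X g"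
    and fg: "\<And>x. x \<in> topspace X \<Longrightarrow> f x \<le> g x"
    and fb: "\<And>x. x \<in> topspace X \<Longrightarrow> f x \<le> b"
    and gb: "\<And>x. x \<in> topspace X \<Longrightarrow> a \<le> g x"
  obtains h where "continuous_map X euclideanreal h"
    "\<And>x. x \<in> topspace X \<Longrightarrow> f x \<le> h x" "\<And>x. x \<in> topspace X \<Longrightarrow> h x \<le> g x"
proof -
  define d where "d = \<bar>b - a\<bar> + 1"
  define r where "r = (\<lambda>n. d * (2/3) ^ n)"
  have d: "0 < d" and r: "\<And>n. 0 < r n" and rSuc: "\<And>n. r (Suc n) = 2/3 * r n"
    by (auto simp: d_def r_def)
  define P where "P = (\<lambda>n S. continuous_map X euclideanreal S \<and>
      (\<forall>x \<in> topspace X. f x \<le> S x + r n) \<and> (\<forall>x \<in> topspace X. S x \<le> g x))"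
  have "\<exists>S. \<forall>n. P n (S n) \<and> (\<forall>x \<in> topspace X. \<bar>S (Suc n) x - S n x\<bar> \<le> 1/3 * r n)"
  proof (rule dependent_nat_choice)
    \<comment> \<open>The constant \<open>a\<close> lies below \<open>g\<close>, and its gap to
      \<open>f\<close> is at most \<open>b - a\<close>, hence at most
      \<open>r 0 = d\<close>.\<close>
    show "\<exists>S. P 0 S"
      using fb gb by (intro exI[of _ "\<lambda>x. a"]) (force simp: P_def r_def d_def)
  next
    fix S n assume "P n S"
    then show "\<exists>S'. P (Suc n) S' \<and> (\<forall>x \<in> topspace X. \<bar>S' x - S x\<bar> \<le> 1/3 * r n)"
      using insertion_step[OF X f g fg _ r[of n], of S] unfolding P_def rSuc by metis
  qed
  then obtain S where S: "\<And>n. P n (S n)"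
    and diff: "\<And>n x. x \<in> topspace X \<Longrightarrow> \<bar>S (Suc n) x - S n x\<bar> \<le> 1/3 * r n"
    by metis
  \<comment> \<open>Since \<open>1/3 * r n = r n - r (Suc n)\<close>, the bounds on the increments
    telescope.\<close>
  have dist: "\<bar>S (n + k) x - S n x\<bar> \<le> r n - r (n + k)" if "x \<in> topspace X" for n k x
  proof (induction k)
    case (Suc k)
    then show ?case
      using diff[OF that, of "n + k"] rSuc[of "n + k"] unfolding add_Suc_right by argo
  qed simp
  have r0: "r \<longlonglongrightarrow> 0"
    unfolding r_def by (intro tendsto_mult_right_zero LIMSEQ_power_zero) auto
  have conv: "convergent (\<lambda>n. S n x)" if x: "x \<in> topspace X" for x
    unfolding Cauchy_convergent_iff[symmetric]
  proof (rule metric_CauchyI)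
    fix e :: real assume "e > 0"
    then obtain N where N: "r N < e / 2"
      using order_tendstoD(2)[OF r0, of "e / 2"] by (auto simp: eventually_sequentially)
    have "\<bar>S n x - S N x\<bar> < e / 2" if "n \<ge> N" for n
      using dist[OF x, of N "n - N"] that N r[of n] by simp
    then show "\<exists>M. \<forall>m\<ge>M. \<forall>n\<ge>M. dist (S m x) (S n x) < e"
      unfolding dist_real_def by (intro exI[of _ N]) (smt (verit) field_sum_of_halves)
  qed
  define h where "h = (\<lambda>x. lim (\<lambda>n. S n x))"
  have lim: "(\<lambda>n. S n x) \<longlonglongrightarrow> h x" if "x \<in> topspace X" for x
    using conv[OF that] by (simp add: h_def convergent_LIMSEQ_iff)
  have hS: "\<bar>h x - S n x\<bar> \<le> r n" if x: "x \<in> topspace X" for n x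
  proof (rule LIMSEQ_le_const2)
    show "(\<lambda>k. \<bar>S (k + n) x - S n x\<bar>) \<longlonglongrightarrow> \<bar>h x - S n x\<bar>"
      by (intro tendsto_intros LIMSEQ_ignore_initial_segment lim x)
    show "\<exists>N. \<forall>k\<ge>N. \<bar>S (k + n) x - S n x\<bar> \<le> r n"
      using dist[OF x, of n] r by (metis add.commute add_increasing2 diff_add_cancel less_eq_real_def order.trans le_diff_eq diff_ge_0_iff_ge)
  qed
  show thesis
  proof
    have "continuous_map X Met_TC.mtopology h"
    proof (rule Met_TC.continuous_map_uniform_limit)
      show "\<forall>\<^sub>F n in sequentially. continuous_map X Met_TC.mtopology (S n)"
        using S by (simp add: P_def)
      show "\<forall>\<^sub>F n in sequentially. \<forall>x\<in>topspace X. h x \<in> UNIV \<and> dist (S n x) (h x) < e"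
        if "0 < e" for e
        using order_tendstoD(2)[OF r0 that]
        by eventually_elim (use hS in \<open>auto simp: dist_real_def abs_minus_commute intro: le_less_trans\<close>)
    qed simp
    then show "continuous_map X euclideanreal h" by simp
  next
    fix x assume x: "x \<in> topspace X"
    have "(\<lambda>n. S n x + r n) \<longlonglongrightarrow> h x + 0"
      by (intro tendsto_intros lim x r0)
    then show "f x \<le> h x"
      using S x by (intro LIMSEQ_le_const[where X="\<lambda>n. S n x + r n"]) (auto simp: P_def)
    show "h x \<le> g x"
      using S x by (intro LIMSEQ_le_const2[OF lim[OF x]]) (auto simp: P_def)
  qed
qed

section \<open>Geometry of the hedgehog\<close>

text \<open>
  For \<open>B = {\<alpha>}\<close> this is the signed coordinate along the line through the spine \<open>\<alpha>\<close>, all other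
  spines being folded onto the negative half-line; for \<open>B = UNIV\<close> it is the distance to the origin.
\<close>

fun coord :: "'i set \<Rightarrow> 'i hedgehog_point \<Rightarrow> real" where
  "coord B Origin = 0"
| "coord B (Spine s \<alpha>) = (if \<alpha> \<in> B then s else - s)"

text \<open>\<open>Origin\<close> serves as the point with parameter 0 on every spine, so that one
  formula covers a whole closed spine.\<close>

definition spine_point :: "'i \<Rightarrow> real \<Rightarrow> 'i hedgehog_point" where
  "spine_point \<alpha> c = (if c = 0 then Origin else Spine c \<alpha>)"

text \<open>\<open>move \<beta> s y\<close> is the point at distance \<open>s\<close> from \<open>y\<close> on the way to the tip of the spine \<open>\<beta>\<close>.\<close>

fun move :: "'i \<Rightarrow> real \<Rightarrow> 'i hedgehog_point \<Rightarrow> 'i hedgehog_point" where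
  "move \<beta> s Origin = spine_point \<beta> s"
| "move \<beta> s (Spine m \<alpha>) =
    (if \<alpha> = \<beta> then Spine (m + s) \<beta> else if s < m then Spine (m - s) \<alpha> else spine_point \<beta> (s - m))"

lemma hedgehog_points_simps [simp]:
  "Origin \<in> hedgehog_points A"
  "Spine s \<alpha> \<in> hedgehog_points A \<longleftrightarrow> 0 < s \<and> s \<le> 1 \<and> \<alpha> \<in> A"
  by (auto simp: hedgehog_points_def)

lemma spine_point_in_hedgehog [simp]:
  "spine_point \<alpha> c \<in> hedgehog_points A \<longleftrightarrow> c = 0 \<or> 0 < c \<and> c \<le> 1 \<and> \<alpha> \<in> A"
  by (auto simp: spine_point_def)

lemma coord_spine_point [simp]: "coord B (spine_point \<alpha> c) = (if \<alpha> \<in> B then c else - c)"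
  by (simp add: spine_point_def)

lemma abs_coord_le_1: "y \<in> hedgehog_points A \<Longrightarrow> \<bar>coord B y\<bar> \<le> 1"
  by (cases y) auto

lemma coord_UNIV_nonneg: "y \<in> hedgehog_points A \<Longrightarrow> 0 \<le> coord UNIV y"
  by (cases y) auto

lemma coord_le_coord_UNIV: "y \<in> hedgehog_points A \<Longrightarrow> coord B y \<le> coord UNIV y"
  by (cases y) auto

text \<open>A positive value of \<open>coord B\<close> comes from the single spine carrying the
  point. Above a positive threshold, one continuous function thus watches all spines of
  \<open>B\<close> at once.\<close>

lemma coord_pos_iff:
  "y \<in> hedgehog_points A \<Longrightarrow> c \<le> coord B y \<and> 0 < c \<longleftrightarrow> (\<exists>\<alpha>\<in>A \<inter> B. c \<le> coord {\<alpha>} y) \<and> 0 < c"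
  by (cases y) auto

lemma coord_eq_imp_spine_point:
  "y \<in> hedgehog_points A \<Longrightarrow> coord {\<alpha>} y = c \<Longrightarrow> 0 \<le> c \<Longrightarrow> y = spine_point \<alpha> c"
  by (cases y) (auto simp: spine_point_def split: if_splits)

lemma coord_Lipschitz:
  "y \<in> hedgehog_points A \<Longrightarrow> z \<in> hedgehog_points A \<Longrightarrow>
    \<bar>coord B y - coord B z\<bar> \<le> hedgehog_dist y z"
  by (cases y; cases z) auto

lemma move_0 [simp]: "y \<in> hedgehog_points A \<Longrightarrow> move \<beta> 0 y = y"
  by (cases y) (auto simp: spine_point_def)

text \<open>Moving by \<open>s\<close> raises \<open>coord {\<beta>}\<close> by exactly
  \<open>s\<close>, so the last hypothesis stops the motion at the tip of
  \<open>\<beta>\<close>.\<close>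

lemma move_in_hedgehog:
  "y \<in> hedgehog_points A \<Longrightarrow> \<beta> \<in> A \<Longrightarrow> 0 \<le> s \<Longrightarrow> coord {\<beta>} y + s \<le> 1 \<Longrightarrow> move \<beta> s y \<in> hedgehog_points A"
  by (cases y) (auto split: if_splits)

lemma dist_move:
  "y \<in> hedgehog_points A \<Longrightarrow> 0 \<le> s \<Longrightarrow> hedgehog_dist y (move \<beta> s y) = s"
  by (cases y) (auto simp: spine_point_def)

text \<open>Paths towards a common tip merge and then run together, so only the difference of the
  travelled lengths can push the points apart. This yields continuity of the branches in both
  variables jointly.\<close>

lemma dist_move_move:
  "y \<in> hedgehog_points A \<Longrightarrow> z \<in> hedgehog_points A \<Longrightarrow> 0 \<le> s \<Longrightarrow> 0 \<le> t \<Longrightarrow>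
    hedgehog_dist (move \<beta> s y) (move \<beta> t z) \<le> hedgehog_dist y z + \<bar>s - t\<bar>"
  by (cases y; cases z; auto simp: spine_point_def; simp add: abs_if)

lemma move_to_spine_point:
  "\<lbrakk>0 \<le> m; m \<le> c\<rbrakk> \<Longrightarrow> move \<alpha> (c - m) (spine_point \<alpha> m) = spine_point \<alpha> c"
  by (auto simp: spine_point_def)

text \<open>The condition \<open>0 \<le> c\<close> is what makes \<open>spine_point \<alpha> c\<close> the only point with \<open>coord {\<alpha>}\<close> equal to \<open>c\<close>.\<close>

definition spinewise_convex :: "'i hedgehog_point set \<Rightarrow> bool" where
  "spinewise_convex K \<longleftrightarrow>
    (\<forall>a\<in>K. \<forall>b\<in>K. \<forall>\<alpha> c. coord {\<alpha>} a \<le> c \<and> c \<le> coord {\<alpha>} b \<and> 0 \<le> c \<longrightarrow> spine_point \<alpha> c \<in> K)"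

lemma spinewise_convexD:
  "\<lbrakk>spinewise_convex K; a \<in> K; b \<in> K; coord {\<alpha>} a \<le> c; c \<le> coord {\<alpha>} b; 0 \<le> c\<rbrakk> \<Longrightarrow> spine_point \<alpha> c \<in> K"
  by (auto simp: spinewise_convex_def)

text \<open>The path from \<open>y\<close> first descends the spine of \<open>y\<close>, if that is
  not \<open>\<beta>\<close>, and then climbs \<open>\<beta>\<close>. While it descends, convexity
  is applied along the spine of \<open>y\<close>, from \<open>z\<close> to \<open>y\<close>;
  otherwise along \<open>\<beta>\<close>, from \<open>y\<close> to \<open>z\<close>.\<close>

lemma move_in_spinewise_convex:
  assumes K: "spinewise_convex K" "K \<subseteq> hedgehog_points A"
    and y: "y \<in> K" and z: "z \<in> K" and s: "0 \<le> s" "coord {\<beta>} y + s \<le> coord {\<beta>} z"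
  shows "move \<beta> s y \<in> K"
proof (cases y)
  case Origin
  then show ?thesis
    using spinewise_convexD[OF K(1) y z, of \<beta> s] s by simp
next
  case (Spine m \<alpha>)
  have m: "0 < m" using K y Spine by auto
  consider "\<alpha> = \<beta>" | "\<alpha> \<noteq> \<beta>" "s < m" | "\<alpha> \<noteq> \<beta>" "m \<le> s" by linarith
  then show ?thesis
  proof cases
    case 1
    then show ?thesis
      using spinewise_convexD[OF K(1) y z, of \<beta> "m + s"] s m Spine by (simp add: spine_point_def)
  next
    case 2
    \<comment> \<open>\<open>z\<close> lies on at most one of the two spines, so its signed
      coordinates along them have a nonpositive sum.\<close>
    have "coord {\<alpha>} z \<le> - coord {\<beta>} z"
      using K z 2 by (cases z) auto
    then show ?thesis
      using spinewise_convexD[OF K(1) z y, of \<alpha> "m - s"] s m Spine 2 by (simp add: spine_point_def)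
  next
    case 3
    then show ?thesis
      using spinewise_convexD[OF K(1) y z, of \<beta> "s - m"] s m Spine by simp
  qed
qed

section \<open>Topology of the hedgehog\<close>

lemma continuous_map_coord: "continuous_map (hedgehog A) euclideanreal (coord B)"
  unfolding hedgehog_def Metric_space.continuous_map_from_metric[OF Metric_space_hedgehog]
proof (intro conjI ballI allI impI)
  fix a U assume a: "a \<in> hedgehog_points A" and U: "openin euclideanreal U \<and> coord B a \<in> U"
  then obtain r where r: "r > 0" "\<And>t. \<bar>t - coord B a\<bar> < r \<Longrightarrow> t \<in> U"
    by (auto simp: open_dist dist_real_def)
  have "coord B x \<in> U" if "x \<in> hedgehog_points A" "hedgehog_dist a x < r" for x
    using coord_Lipschitz[OF a that(1), of B] that(2) by (intro r) (simp add: abs_minus_commute)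
  with r show "\<exists>r>0. \<forall>x. x \<in> hedgehog_points A \<and> hedgehog_dist a x < r \<longrightarrow> coord B x \<in> U"
    by blast
qed auto

lemma openin_coord_gt: "openin (hedgehog A) {y \<in> hedgehog_points A. c < coord B y}"
  using continuous_map_coord[of A B]
  by (auto simp: continuous_map_upper_lower_semicontinuous_lt topspace_hedgehog)

lemma openin_coord_lt: "openin (hedgehog A) {y \<in> hedgehog_points A. coord B y < c}"
  using continuous_map_coord[of A B]
  by (auto simp: continuous_map_upper_lower_semicontinuous_lt topspace_hedgehog)

lemma closedin_coord_ge: "closedin (hedgehog A) {y \<in> hedgehog_points A. c \<le> coord B y}"
  using continuous_map_coord[of A B]
  by (auto simp: continuous_map_upper_lower_semicontinuous_le topspace_hedgehog)

lemma continuous_map_into_hedgehog: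
  "continuous_map X (hedgehog A) f \<longleftrightarrow>
    f \<in> topspace X \<rightarrow> hedgehog_points A \<and>
    (\<forall>x \<in> topspace X. \<forall>\<epsilon>>0. \<exists>U. openin X U \<and> x \<in> U \<and> (\<forall>y\<in>U. hedgehog_dist (f x) (f y) < \<epsilon>))"
proof -
  interpret Metric_space "hedgehog_points A" hedgehog_dist
    by (rule Metric_space_hedgehog)
  show ?thesis
  proof (intro iffI conjI ballI allI impI)
    assume f: "continuous_map X (hedgehog A) f"
    then show "f \<in> topspace X \<rightarrow> hedgehog_points A"
      by (metis continuous_map_def topspace_hedgehog)
    show "\<exists>U. openin X U \<and> x \<in> U \<and> (\<forall>y\<in>U. hedgehog_dist (f x) (f y) < \<epsilon>)"
      if "x \<in> topspace X" "0 < \<epsilon>" for x \<epsilon>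
      using f that unfolding hedgehog_def continuous_map_to_metric by (metis in_mball)
  next
    assume f: "f \<in> topspace X \<rightarrow> hedgehog_points A \<and>
      (\<forall>x \<in> topspace X. \<forall>\<epsilon>>0. \<exists>U. openin X U \<and> x \<in> U \<and> (\<forall>y\<in>U. hedgehog_dist (f x) (f y) < \<epsilon>))"
    show "continuous_map X (hedgehog A) f"
      unfolding hedgehog_def continuous_map_to_metric
    proof (intro ballI allI impI)
      fix x and \<epsilon> :: real assume "x \<in> topspace X" "0 < \<epsilon>"
      with f obtain U where U: "openin X U" "x \<in> U" "\<And>y. y \<in> U \<Longrightarrow> hedgehog_dist (f x) (f y) < \<epsilon>"
        by metis
      then have "\<forall>y\<in>U. f y \<in> mball (f x) \<epsilon>"
        using f openin_subset[OF U(1)] by (auto simp: Pi_iff subset_iff)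
      with U show "\<exists>U. openin X U \<and> x \<in> U \<and> (\<forall>y\<in>U. f y \<in> mball (f x) \<epsilon>)"
        by blast
    qed
  qed
qed

lemma openin_hedgehog_dist:
  assumes "openin (hedgehog A) U" "y \<in> U"
  obtains \<epsilon> where "0 < \<epsilon>" "\<And>z. z \<in> hedgehog_points A \<Longrightarrow> hedgehog_dist y z < \<epsilon> \<Longrightarrow> z \<in> U"
proof -
  interpret Metric_space "hedgehog_points A" hedgehog_dist
    by (rule Metric_space_hedgehog)
  show thesis
    using assms that unfolding hedgehog_def openin_mtopology by (metis in_mball subset_iff)
qed

lemma continuous_map_move:
  assumes e: "continuous_map Z (hedgehog A) e" and \<sigma>: "continuous_map Z euclideanreal \<sigma>"
    and \<beta>: "\<beta> \<in> A"
    and \<sigma>0: "\<And>z. z \<in> topspace Z \<Longrightarrow> 0 \<le> \<sigma> z"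
    and \<sigma>1: "\<And>z. z \<in> topspace Z \<Longrightarrow> coord {\<beta>} (e z) + \<sigma> z \<le> 1"
  shows "continuous_map Z (hedgehog A) (\<lambda>z. move \<beta> (\<sigma> z) (e z))"
  unfolding continuous_map_into_hedgehog
proof (intro conjI ballI allI impI)
  have eA: "e z \<in> hedgehog_points A" if "z \<in> topspace Z" for z
    using e that by (auto simp: continuous_map_into_hedgehog)
  then show "(\<lambda>z. move \<beta> (\<sigma> z) (e z)) \<in> topspace Z \<rightarrow> hedgehog_points A"
    using \<sigma>0 \<sigma>1 \<beta> by (auto intro!: move_in_hedgehog)
  fix z and \<epsilon> :: real assume z: "z \<in> topspace Z" and \<epsilon>: "0 < \<epsilon>"
  then obtain U where U: "openin Z U" "z \<in> U" "\<And>y. y \<in> U \<Longrightarrow> hedgehog_dist (e z) (e y) < \<epsilon> / 2"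
    using e unfolding continuous_map_into_hedgehog by (meson half_gt_zero)
  define V where "V = {y \<in> topspace Z. \<sigma> y < \<sigma> z + \<epsilon> / 2} \<inter> {y \<in> topspace Z. \<sigma> z - \<epsilon> / 2 < \<sigma> y}"
  have V: "openin Z V"
    unfolding V_def using \<sigma> by (intro openin_Int) (auto simp: continuous_map_upper_lower_semicontinuous_lt)
  show "\<exists>U. openin Z U \<and> z \<in> U \<and> (\<forall>y\<in>U. hedgehog_dist (move \<beta> (\<sigma> z) (e z)) (move \<beta> (\<sigma> y) (e y)) < \<epsilon>)"
  proof (intro exI[of _ "U \<inter> V"] conjI ballI)
    show "openin Z (U \<inter> V)" "z \<in> U \<inter> V"
      using U V z \<epsilon> by (auto simp: V_def)
    fix y assume y: "y \<in> U \<inter> V"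
    then have "y \<in> topspace Z" "\<sigma> y < \<sigma> z + \<epsilon> / 2" "\<sigma> z - \<epsilon> / 2 < \<sigma> y"
      by (auto simp: V_def)
    moreover from this have "\<bar>\<sigma> z - \<sigma> y\<bar> < \<epsilon> / 2"
      by argo
    ultimately show "hedgehog_dist (move \<beta> (\<sigma> z) (e z)) (move \<beta> (\<sigma> y) (e y)) < \<epsilon>"
      using dist_move_move[OF eA[OF z] eA \<sigma>0[OF z] \<sigma>0, of y y \<beta>] U(3)[of y] y by auto
  qed
qed

text \<open>The ball of radius \<open>\<epsilon>\<close> about the origin and the pairwise disjoint
  open spines cover \<open>K\<close>. A point of \<open>K\<close> at height at least
  \<open>\<epsilon>\<close> lies in no other member than its own spine, which therefore belongs to
  any finite subcover.\<close>

lemma finite_spines_of_compact: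
  assumes K: "compactin (hedgehog A) K" and \<epsilon>: "0 < \<epsilon>"
  shows "finite {\<alpha> \<in> A. \<exists>y\<in>K. \<epsilon> \<le> coord {\<alpha>} y}"
proof -
  define U where "U = (\<lambda>\<alpha>. {y \<in> hedgehog_points A. 0 < coord {\<alpha>} y})"
  define U0 where "U0 = {y \<in> hedgehog_points A. coord UNIV y < \<epsilon>}"
  have KA: "K \<subseteq> hedgehog_points A"
    using compactin_subset_topspace[OF K] by (simp add: topspace_hedgehog)
  have "K \<subseteq> \<Union> (insert U0 (U ` A))"
  proof
    fix y assume "y \<in> K"
    then have y: "y \<in> hedgehog_points A"
      using KA by blast
    show "y \<in> \<Union> (insert U0 (U ` A))"
    proof (cases y)
      case Origin
      then show ?thesis using \<epsilon> by (simp add: U0_def)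
    next
      case (Spine s \<alpha>)
      with y have "y \<in> U \<alpha>" "\<alpha> \<in> A" by (auto simp: U_def)
      then show ?thesis by blast
    qed
  qed
  moreover have "\<forall>V \<in> insert U0 (U ` A). openin (hedgehog A) V"
    by (auto simp: U0_def U_def openin_coord_gt openin_coord_lt)
  ultimately obtain \<F> where \<F>: "finite \<F>" "\<F> \<subseteq> insert U0 (U ` A)" "K \<subseteq> \<Union> \<F>"
    using K unfolding compactin_def by metis
  have eq: "\<alpha> = \<beta>" if "y \<in> U \<alpha>" "y \<in> U \<beta>" for y \<alpha> \<beta>
    using that by (cases y) (auto simp: U_def split: if_splits)
  have "U \<alpha> \<in> \<F>" if asm: "\<alpha> \<in> A" "y \<in> K" "\<epsilon> \<le> coord {\<alpha>} y" for \<alpha> y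
  proof -
    have y: "y \<in> U \<alpha>" "y \<notin> U0"
      using asm \<epsilon> KA coord_le_coord_UNIV[of y A "{\<alpha>}"] by (auto simp: U_def U0_def)
    obtain V where V: "V \<in> \<F>" "y \<in> V"
      using \<F>(3) asm(2) by blast
    then obtain \<beta> where "V = U \<beta>"
      using \<F>(2) y(2) by blast
    then show ?thesis
      using V y(1) eq by metis
  qed
  moreover have "inj_on U A"
  proof
    fix \<alpha> \<beta> assume "\<alpha> \<in> A" "U \<alpha> = U \<beta>"
    moreover from \<open>\<alpha> \<in> A\<close> have "Spine 1 \<alpha> \<in> U \<alpha>" by (simp add: U_def)
    ultimately show "\<alpha> = \<beta>" using eq by metis
  qed
  ultimately have "U ` {\<alpha> \<in> A. \<exists>y\<in>K. \<epsilon> \<le> coord {\<alpha>} y} \<subseteq> \<F>"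
      and "inj_on U {\<alpha> \<in> A. \<exists>y\<in>K. \<epsilon> \<le> coord {\<alpha>} y}"
    by (auto simp: inj_on_def)
  then show ?thesis
    by (rule finite_imageD[OF finite_subset[OF _ \<F>(1)]])
qed

text \<open>The image of a connected set under \<open>coord {\<alpha>}\<close> is an interval, and a
  value \<open>c \<ge> 0\<close> is taken only at \<open>spine_point \<alpha> c\<close>. The whole
  hedgehog contains all the points in question anyway.\<close>

lemma spinewise_convex_compact_connected':
  assumes "K \<in> compact_connected_sets' (hedgehog A)"
  shows "spinewise_convex K"
proof (cases "K = hedgehog_points A")
  case True
  show ?thesis
    unfolding spinewise_convex_def
  proof (intro ballI allI impI)
    fix a b \<alpha> c assume "b \<in> K" "coord {\<alpha>} a \<le> c \<and> c \<le> coord {\<alpha>} b \<and> 0 \<le> c"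
    then show "spine_point \<alpha> c \<in> K"
      using True by (cases b) (auto split: if_splits)
  qed
next
  case False
  then have K: "connectedin (hedgehog A) K"
    using assms by (auto simp: compact_connected_sets'_def compact_connected_sets_def topspace_hedgehog)
  have KA: "K \<subseteq> hedgehog_points A"
    using connectedin_subset_topspace[OF K] by (simp add: topspace_hedgehog)
  show ?thesis
    unfolding spinewise_convex_def
  proof (intro ballI allI impI)
    fix a b \<alpha> c assume a: "a \<in> K" "b \<in> K" and c: "coord {\<alpha>} a \<le> c \<and> c \<le> coord {\<alpha>} b \<and> 0 \<le> c"
    have "connectedin euclideanreal (coord {\<alpha>} ` K)"
      by (rule connectedin_continuous_map_image[OF continuous_map_coord K])
    then have "c \<in> coord {\<alpha>} ` K"
      using a c connectedD_interval[of "coord {\<alpha>} ` K" "coord {\<alpha>} a" "coord {\<alpha>} b" c] by simp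
    then obtain y where y: "y \<in> K" "coord {\<alpha>} y = c"
      by auto
    then have "y = spine_point \<alpha> c"
      using KA c by (intro coord_eq_imp_spine_point) auto
    with y show "spine_point \<alpha> c \<in> K"
      by simp
  qed
qed

section \<open>Extreme coordinates of the values of a mapping\<close>

lemma bdd_coord:
  assumes "K \<subseteq> hedgehog_points A"
  shows "bdd_above (coord B ` K)" "bdd_below (coord B ` K)"
  using abs_coord_le_1[of _ A B] assms
  by (force intro!: bdd_aboveI[of _ 1] simp: abs_le_iff, force intro!: bdd_belowI[of _ "-1"] simp: abs_le_iff)

lemma compact_connected_sets'_subset:
  assumes "K \<in> compact_connected_sets' (hedgehog A)"
  shows "K \<noteq> {} \<and> K \<subseteq> hedgehog_points A"
  using assms compactin_subset_topspace[of "hedgehog A" K]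
  by (auto simp: hedgehog_points_def compact_connected_sets'_def compact_connected_sets_def compact_sets_def topspace_hedgehog)

text \<open>Compactness provides the minimum, except for the whole hedgehog, which may fail to be
  compact; there the origin attains it.\<close>

lemma coord_attains_INF:
  assumes K: "K \<in> compact_connected_sets' (hedgehog A)"
  obtains z where "z \<in> K" "coord UNIV z = (INF y\<in>K. coord UNIV y)"
proof -
  have "\<exists>z\<in>K. \<forall>y\<in>K. coord UNIV z \<le> coord UNIV y"
  proof (cases "K = hedgehog_points A")
    case True
    then show ?thesis
      using coord_UNIV_nonneg by (intro bexI[of _ Origin]) auto
  next
    case False
    then have "compactin (hedgehog A) K" "K \<noteq> {}"
      using K by (auto simp: compact_connected_sets'_def compact_connected_sets_def
          compact_sets_def topspace_hedgehog)
    then show ?thesis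
      using compact_attains_inf[of "coord UNIV ` K"] image_compactin[OF _ continuous_map_coord, of A K UNIV]
      by auto
  qed
  then obtain z where "z \<in> K" "\<forall>y\<in>K. coord UNIV z \<le> coord UNIV y" ..
  then show thesis
    by (intro that[of z]) (auto intro!: cInf_eq_minimum[symmetric])
qed

text \<open>As for the infimum, with the tip of \<open>\<beta>\<close> as the maximizer in the whole
  hedgehog. The maximizer is later the endpoint to which a branch may grow inside
  \<open>\<Phi> x\<close>.\<close>

lemma coord_attains_SUP:
  assumes K: "K \<in> compact_connected_sets' (hedgehog A)" and \<beta>: "\<beta> \<in> A"
  obtains z where "z \<in> K" "coord {\<beta>} z = (SUP y\<in>K. coord {\<beta>} y)"
proof -
  have "\<exists>z\<in>K. \<forall>y\<in>K. coord {\<beta>} y \<le> coord {\<beta>} z"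
  proof (cases "K = hedgehog_points A")
    case True
    then show ?thesis
      using \<beta> abs_coord_le_1[of _ A "{\<beta>}"] by (intro bexI[of _ "Spine 1 \<beta>"]) (auto simp: abs_le_iff)
  next
    case False
    then have "compactin (hedgehog A) K" "K \<noteq> {}"
      using K by (auto simp: compact_connected_sets'_def compact_connected_sets_def
          compact_sets_def topspace_hedgehog)
    then show ?thesis
      using compact_attains_sup[of "coord {\<beta>} ` K"] image_compactin[OF _ continuous_map_coord, of A K "{\<beta>}"]
      by auto
  qed
  then obtain z where "z \<in> K" "\<forall>y\<in>K. coord {\<beta>} y \<le> coord {\<beta>} z" ..
  then show thesis
    by (intro that[of z]) (auto intro!: cSup_eq_maximum[symmetric])
qed

section \<open>Extrema of real functions over set-valued mappings\<close>

lemma lower_semicontinuous_SUP: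
  fixes h :: "'b \<Rightarrow> real"
  assumes \<Phi>: "lsc_map X Y \<Phi>" and h: "continuous_map Y euclideanreal h"
    and ne: "\<And>x. x \<in> topspace X \<Longrightarrow> \<Phi> x \<noteq> {} \<and> \<Phi> x \<subseteq> topspace Y"
    and bdd: "bdd_above (h ` topspace Y)"
  shows "lower_semicontinuous X (\<lambda>x. SUP y\<in>\<Phi> x. h y)"
  unfolding lower_semicontinuous_def
proof
  fix c
  have "{x \<in> topspace X. c < (SUP y\<in>\<Phi> x. h y)} = {x \<in> topspace X. \<Phi> x \<inter> {y \<in> topspace Y. c < h y} \<noteq> {}}"
  proof (rule Collect_cong, rule conj_cong[OF refl])
    fix x assume x: "x \<in> topspace X"
    have "bdd_above (h ` \<Phi> x)"
      using bdd ne[OF x] by (meson bdd_above_mono image_mono)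
    then show "c < (SUP y\<in>\<Phi> x. h y) \<longleftrightarrow> \<Phi> x \<inter> {y \<in> topspace Y. c < h y} \<noteq> {}"
      using ne[OF x] by (subst less_cSUP_iff) auto
  qed
  moreover have "openin Y {y \<in> topspace Y. c < h y}"
    using h by (auto simp: continuous_map_upper_lower_semicontinuous_lt)
  ultimately show "openin X {x \<in> topspace X. c < (SUP y\<in>\<Phi> x. h y)}"
    using \<Phi> by (simp add: lsc_map_def)
qed

lemma upper_semicontinuous_INF:
  fixes h :: "'b \<Rightarrow> real"
  assumes \<Phi>: "lsc_map X Y \<Phi>" and h: "continuous_map Y euclideanreal h"
    and ne: "\<And>x. x \<in> topspace X \<Longrightarrow> \<Phi> x \<noteq> {} \<and> \<Phi> x \<subseteq> topspace Y"
    and bdd: "bdd_below (h ` topspace Y)"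
  shows "upper_semicontinuous X (\<lambda>x. INF y\<in>\<Phi> x. h y)"
  unfolding upper_semicontinuous_def
proof
  fix c
  have "{x \<in> topspace X. (INF y\<in>\<Phi> x. h y) < c} = {x \<in> topspace X. \<Phi> x \<inter> {y \<in> topspace Y. h y < c} \<noteq> {}}"
  proof (rule Collect_cong, rule conj_cong[OF refl])
    fix x assume x: "x \<in> topspace X"
    have "bdd_below (h ` \<Phi> x)"
      using bdd ne[OF x] by (meson bdd_below_mono image_mono)
    then show "(INF y\<in>\<Phi> x. h y) < c \<longleftrightarrow> \<Phi> x \<inter> {y \<in> topspace Y. h y < c} \<noteq> {}"
      using ne[OF x] by (subst cINF_less_iff) auto
  qed
  moreover have "openin Y {y \<in> topspace Y. h y < c}"
    using h by (auto simp: continuous_map_upper_lower_semicontinuous_lt)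
  ultimately show "openin X {x \<in> topspace X. (INF y\<in>\<Phi> x. h y) < c}"
    using \<Phi> by (simp add: lsc_map_def)
qed

lemma usc_map_openin:
  assumes \<theta>: "usc_map X Y \<theta>" and U: "openin Y U"
    and sub: "\<And>x. x \<in> topspace X \<Longrightarrow> \<theta> x \<subseteq> topspace Y"
  shows "openin X {x \<in> topspace X. \<theta> x \<subseteq> U}"
proof -
  have "closedin X {x \<in> topspace X. \<theta> x \<inter> (topspace Y - U) \<noteq> {}}"
    using \<theta> U by (auto simp: usc_map_def)
  moreover have eq: "{x \<in> topspace X. \<theta> x \<subseteq> U} = topspace X - {x \<in> topspace X. \<theta> x \<inter> (topspace Y - U) \<noteq> {}}"
    using sub by auto
  ultimately show ?thesis
    unfolding eq by (intro openin_diff openin_topspace)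
qed

lemma upper_semicontinuous_SUP:
  fixes h :: "'b \<Rightarrow> real"
  assumes \<theta>: "usc_map X Y \<theta>" and h: "continuous_map Y euclideanreal h"
    and ne: "\<And>x. x \<in> topspace X \<Longrightarrow> \<theta> x \<noteq> {} \<and> \<theta> x \<subseteq> topspace Y"
    and bdd: "bdd_above (h ` topspace Y)"
  shows "upper_semicontinuous X (\<lambda>x. SUP y\<in>\<theta> x. h y)"
  unfolding upper_semicontinuous_def
proof
  fix c
  \<comment> \<open>Having all values below \<open>c\<close> would only bound the supremum by
    \<open>c\<close>; the intermediate level \<open>d\<close> restores strictness.\<close>
  have "{x \<in> topspace X. (SUP y\<in>\<theta> x. h y) < c}
      = (\<Union>d\<in>{..<c}. {x \<in> topspace X. \<theta> x \<subseteq> {y \<in> topspace Y. h y < d}})" (is "?L = ?R")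
  proof (intro equalityI subsetI)
    fix x assume "x \<in> ?L"
    then have x: "x \<in> topspace X" "(SUP y\<in>\<theta> x. h y) < c"
      by auto
    then obtain d where d: "(SUP y\<in>\<theta> x. h y) < d" "d < c"
      using dense by blast
    have "bdd_above (h ` \<theta> x)"
      using bdd ne[OF x(1)] by (meson bdd_above_mono image_mono)
    then have "h y < d" if "y \<in> \<theta> x" for y
      using cSUP_upper[OF that] d by force
    with x(1) d(2) ne[OF x(1)] show "x \<in> ?R" by (auto intro!: bexI[of _ d])
  next
    fix x assume "x \<in> ?R"
    then obtain d where d: "d < c" "x \<in> topspace X" "\<And>y. y \<in> \<theta> x \<Longrightarrow> h y < d"
      by auto
    then have "(SUP y\<in>\<theta> x. h y) \<le> d"
      using ne[OF d(2)] by (intro cSUP_least) (auto intro: less_imp_le)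
    with d show "x \<in> ?L" by auto
  qed
  moreover have "openin X {x \<in> topspace X. \<theta> x \<subseteq> {y \<in> topspace Y. h y < d}}" for d
    using h by (intro usc_map_openin[OF \<theta>] ne[THEN conjunct2])
      (auto simp: continuous_map_upper_lower_semicontinuous_lt)
  ultimately show "openin X {x \<in> topspace X. (SUP y\<in>\<theta> x. h y) < c}"
    by (auto intro!: openin_Union)
qed

text \<open>By compactness, \<open>\<theta> x\<close> reaches height \<open>\<epsilon>\<close> on a
  finite set \<open>B\<close> of spines only. Staying below \<open>\<epsilon>\<close> on all other
  spines is the single open condition \<open>coord (A - B) y < \<epsilon>\<close>, so by upper
  semi-continuity it persists near \<open>x\<close>.\<close>

lemma locally_finite_spines:
  assumes \<theta>: "usc_map X (hedgehog A) \<theta>" and c\<theta>: "\<theta> \<in> topspace X \<rightarrow> compact_sets (hedgehog A)"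
    and \<epsilon>: "0 < \<epsilon>"
  shows "locally_finite_family X A (\<lambda>\<alpha>. {x \<in> topspace X. \<exists>y\<in>\<theta> x. \<epsilon> \<le> coord {\<alpha>} y})"
  unfolding locally_finite_family_def
proof (intro conjI ballI)
  fix x assume x: "x \<in> topspace X"
  have K: "compactin (hedgehog A) (\<theta> z)" and KA: "\<theta> z \<subseteq> hedgehog_points A" if "z \<in> topspace X" for z
    using c\<theta> compactin_subset_topspace that by (fastforce simp: compact_sets_def topspace_hedgehog)+
  define B where "B = {\<alpha> \<in> A. \<exists>y\<in>\<theta> x. \<epsilon> \<le> coord {\<alpha>} y}"
  define V where "V = {z \<in> topspace X. \<theta> z \<subseteq> {y \<in> hedgehog_points A. coord (A - B) y < \<epsilon>}}"
  have V: "openin X V"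
    unfolding V_def
    by (intro usc_map_openin[OF \<theta>] openin_coord_lt) (use KA in \<open>auto simp: topspace_hedgehog\<close>)
  have lt: "coord (A - B) y < \<epsilon>" if "y \<in> \<theta> x" for y
  proof (rule ccontr)
    assume "\<not> coord (A - B) y < \<epsilon>"
    then have "\<exists>\<alpha>\<in>A \<inter> (A - B). \<epsilon> \<le> coord {\<alpha>} y"
      using coord_pos_iff[of y A \<epsilon> "A - B"] \<epsilon> KA[OF x] that by force
    then show False
      using that by (auto simp: B_def)
  qed
  have "x \<in> V"
    using lt x KA[OF x] by (auto simp: V_def)
  moreover have "{\<alpha> \<in> A. {x \<in> topspace X. \<exists>y\<in>\<theta> x. \<epsilon> \<le> coord {\<alpha>} y} \<inter> V \<noteq> {}} \<subseteq> B"
  proof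
    fix \<alpha> assume "\<alpha> \<in> {\<alpha> \<in> A. {x \<in> topspace X. \<exists>y\<in>\<theta> x. \<epsilon> \<le> coord {\<alpha>} y} \<inter> V \<noteq> {}}"
    then obtain z y where z: "\<alpha> \<in> A" "z \<in> V" "y \<in> \<theta> z" "\<epsilon> \<le> coord {\<alpha>} y"
      by auto
    then have "y \<in> hedgehog_points A" "coord (A - B) y < \<epsilon>"
      by (auto simp: V_def)
    then show "\<alpha> \<in> B"
      using coord_pos_iff[of y A \<epsilon> "A - B"] z \<epsilon> by force
  qed
  moreover have "finite B"
    unfolding B_def by (rule finite_spines_of_compact[OF K[OF x] \<epsilon>])
  ultimately show "\<exists>V. openin X V \<and> x \<in> V \<and>
      finite {\<alpha> \<in> A. {x \<in> topspace X. \<exists>y\<in>\<theta> x. \<epsilon> \<le> coord {\<alpha>} y} \<inter> V \<noteq> {}}"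
    using V by (intro exI[of _ V]) (auto intro: finite_subset)
qed auto

section \<open>Continuous tree-valued mappings\<close>

text \<open>\<open>e x\<close> is the root of a tree and \<open>w \<beta> x\<close> the length of
  its branch towards the tip of \<open>\<beta>\<close>. The last assumption compensates for a
  possibly infinite \<open>A\<close>: near each point, all but finitely many branches stay close to
  the root.\<close>

locale hedgehog_branches =
  fixes X :: "'a topology" and A :: "'i set"
    and e :: "'a \<Rightarrow> 'i hedgehog_point" and w :: "'i \<Rightarrow> 'a \<Rightarrow> real"
  assumes A_nonempty: "A \<noteq> {}"
    and continuous_e: "continuous_map X (hedgehog A) e"
    and continuous_w: "\<beta> \<in> A \<Longrightarrow> continuous_map X euclideanreal (w \<beta>)"
    and w_nonneg: "\<lbrakk>\<beta> \<in> A; x \<in> topspace X\<rbrakk> \<Longrightarrow> 0 \<le> w \<beta> x"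
    and w_upper: "\<lbrakk>\<beta> \<in> A; x \<in> topspace X\<rbrakk> \<Longrightarrow> coord {\<beta>} (e x) + w \<beta> x \<le> 1"
    and w_locally_finite:
      "0 < \<epsilon> \<Longrightarrow> locally_finite_family X A (\<lambda>\<beta>. {x \<in> topspace X. \<epsilon> < w \<beta> x})"
begin

definition tree :: "'a \<Rightarrow> 'i hedgehog_point set" where
  "tree x = (\<Union>\<beta>\<in>A. (\<lambda>s. move \<beta> s (e x)) ` {0..w \<beta> x})"

text \<open>Since \<open>w \<beta> x \<le> 2\<close>, capping at \<open>w \<beta> x\<close> parametrizes every branch over the compact \<open>{0..2}\<close>.\<close>

definition branch_map :: "'i \<Rightarrow> 'a \<times> real \<Rightarrow> 'i hedgehog_point" where
  "branch_map \<beta> p = move \<beta> (min (snd p) (w \<beta> (fst p))) (e (fst p))"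

lemma e_in: "x \<in> topspace X \<Longrightarrow> e x \<in> hedgehog_points A"
  using continuous_e by (auto simp: continuous_map_into_hedgehog)

lemma branch_eq:
  assumes "\<beta> \<in> A" "x \<in> topspace X"
  shows "(\<lambda>s. move \<beta> s (e x)) ` {0..w \<beta> x} = (\<lambda>s. branch_map \<beta> (x, s)) ` {0..2}"
proof (intro equalityI subsetI)
  have "w \<beta> x \<le> 2"
    using w_upper[OF assms] abs_coord_le_1[OF e_in[OF assms(2)], of "{\<beta>}"] by linarith
  then show "y \<in> (\<lambda>s. branch_map \<beta> (x, s)) ` {0..2}" if "y \<in> (\<lambda>s. move \<beta> s (e x)) ` {0..w \<beta> x}" for y
    using that by (force simp: branch_map_def)
  show "y \<in> (\<lambda>s. move \<beta> s (e x)) ` {0..w \<beta> x}" if "y \<in> (\<lambda>s. branch_map \<beta> (x, s)) ` {0..2}" for y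
    using that w_nonneg[OF assms] by (force simp: branch_map_def)
qed

lemma tree_eq: "x \<in> topspace X \<Longrightarrow> tree x = (\<Union>\<beta>\<in>A. (\<lambda>s. branch_map \<beta> (x, s)) ` {0..2})"
  by (auto simp: tree_def branch_eq)

lemma e_in_branch:
  assumes "\<beta> \<in> A" "x \<in> topspace X"
  shows "e x \<in> (\<lambda>s. move \<beta> s (e x)) ` {0..w \<beta> x}"
  using w_nonneg[OF assms] e_in[OF assms(2)] by (intro image_eqI[of _ _ 0]) auto

lemma e_in_tree: "x \<in> topspace X \<Longrightarrow> e x \<in> tree x"
  using A_nonempty e_in_branch by (auto simp: tree_def)

section \<open>Continuity, compactness and connectedness of single branches\<close>

lemma continuous_branch_map:
  assumes \<beta>: "\<beta> \<in> A"
  shows "continuous_map (prod_topology X (top_of_set {0..2})) (hedgehog A) (branch_map \<beta>)"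
proof -
  let ?Z = "prod_topology X (top_of_set {0..2::real})"
  have "continuous_map ?Z euclideanreal (\<lambda>p. min (snd p) (w \<beta> (fst p)))"
    by (intro continuous_map_real_min continuous_map_compose[OF continuous_map_fst continuous_w[OF \<beta>], unfolded o_def]
        continuous_map_into_fulltopology[OF continuous_map_snd])
  moreover have "continuous_map ?Z (hedgehog A) (\<lambda>p. e (fst p))"
    by (rule continuous_map_compose[OF continuous_map_fst continuous_e, unfolded o_def])
  ultimately show ?thesis
    unfolding branch_map_def using \<beta> w_nonneg w_upper
    by (intro continuous_map_move) (force simp: min_def intro: order_trans[rotated])+
qed

lemma continuous_branch_map_snd:
  assumes "\<beta> \<in> A" "x \<in> topspace X"
  shows "continuous_map (top_of_set {0..2}) (hedgehog A) (\<lambda>s. branch_map \<beta> (x, s))"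
proof -
  have "continuous_map (top_of_set {0..2::real}) (prod_topology X (top_of_set {0..2})) (\<lambda>s. (x, s))"
    using assms(2) by (intro continuous_map_pairedI) (auto simp: continuous_map_id[unfolded id_def])
  then show ?thesis
    using continuous_map_compose[OF _ continuous_branch_map[OF assms(1)]] by (simp add: o_def)
qed

lemma tree_subset: "x \<in> topspace X \<Longrightarrow> tree x \<subseteq> hedgehog_points A"
  using continuous_branch_map_snd
  by (fastforce simp: tree_eq continuous_map_def topspace_hedgehog)

lemma branch_compact:
  assumes "\<beta> \<in> A" "x \<in> topspace X"
  shows "compactin (hedgehog A) ((\<lambda>s. branch_map \<beta> (x, s)) ` {0..2})"
  by (rule image_compactin[OF _ continuous_branch_map_snd[OF assms]]) (simp add: compactin_subtopology)

lemma branch_connected: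
  assumes "\<beta> \<in> A" "x \<in> topspace X"
  shows "connectedin (hedgehog A) ((\<lambda>s. branch_map \<beta> (x, s)) ` {0..2})"
  by (rule connectedin_continuous_map_image[OF continuous_branch_map_snd[OF assms]])
    (simp add: connectedin_subtopology)

lemma finite_long_branches:
  assumes "x \<in> topspace X" "0 < \<epsilon>"
  obtains V B where "openin X V" "x \<in> V" "finite B" "B \<subseteq> A"
    "\<And>z \<beta>. z \<in> V \<Longrightarrow> \<beta> \<in> A - B \<Longrightarrow> w \<beta> z \<le> \<epsilon>"
proof -
  obtain V where V: "openin X V" "x \<in> V" "finite {\<beta> \<in> A. {x \<in> topspace X. \<epsilon> < w \<beta> x} \<inter> V \<noteq> {}}"
    using w_locally_finite[OF assms(2)] assms(1) unfolding locally_finite_family_def by blast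
  show thesis
    by (rule that[OF V(1,2,3)]) (use openin_subset[OF V(1)] in \<open>force simp: not_le[symmetric]\<close>)+
qed

lemma dist_branch:
  assumes "x \<in> topspace X" "0 \<le> s" "s \<le> w \<beta> x" "w \<beta> x \<le> \<epsilon>"
  shows "hedgehog_dist (e x) (move \<beta> s (e x)) \<le> \<epsilon>"
  using dist_move[OF e_in[OF assms(1)] assms(2)] assms by simp

section \<open>Compactness, connectedness and semicontinuity of the whole tree\<close>

lemma connectedin_tree:
  assumes x: "x \<in> topspace X"
  shows "connectedin (hedgehog A) (tree x)"
  unfolding tree_eq[OF x]
proof (rule connectedin_Union)
  show "connectedin (hedgehog A) S" if "S \<in> (\<lambda>\<beta>. (\<lambda>s. branch_map \<beta> (x, s)) ` {0..2}) ` A" for S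
    using that branch_connected[OF _ x] by auto
  \<comment> \<open>All branches share the root.\<close>
  have "e x \<in> \<Inter> ((\<lambda>\<beta>. (\<lambda>s. branch_map \<beta> (x, s)) ` {0..2}) ` A)"
    using e_in_branch[OF _ x] branch_eq[OF _ x] by simp
  then show "\<Inter> ((\<lambda>\<beta>. (\<lambda>s. branch_map \<beta> (x, s)) ` {0..2}) ` A) \<noteq> {}"
    by blast
qed

text \<open>A member of the cover containing the root contains a ball about it and hence all short
  branches. The finitely many remaining branches are compact.\<close>

lemma compactin_tree:
  assumes x: "x \<in> topspace X"
  shows "compactin (hedgehog A) (tree x)"
  unfolding compactin_def
proof (intro conjI allI impI)
  show "tree x \<subseteq> topspace (hedgehog A)"
    using tree_subset[OF x] by (simp add: topspace_hedgehog)
  fix \<U> assume \<U>: "(\<forall>U\<in>\<U>. openin (hedgehog A) U) \<and> tree x \<subseteq> \<Union> \<U>"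
  then obtain U0 where U0: "U0 \<in> \<U>" "e x \<in> U0" "openin (hedgehog A) U0"
    using e_in_tree[OF x] by blast
  obtain \<epsilon> where \<epsilon>: "0 < \<epsilon>"
      "\<And>z. z \<in> hedgehog_points A \<Longrightarrow> hedgehog_dist (e x) z < \<epsilon> \<Longrightarrow> z \<in> U0"
    using openin_hedgehog_dist[OF U0(3,2)] by blast
  obtain V B where B: "x \<in> V" "finite B" "B \<subseteq> A"
      "\<And>z \<beta>. z \<in> V \<Longrightarrow> \<beta> \<in> A - B \<Longrightarrow> w \<beta> z \<le> \<epsilon> / 2"
    using finite_long_branches[OF x, of "\<epsilon> / 2"] \<epsilon>(1) by (metis half_gt_zero)
  have "compactin (hedgehog A) (\<Union>\<beta>\<in>B. (\<lambda>s. branch_map \<beta> (x, s)) ` {0..2})"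
    using B branch_compact[OF _ x] by (intro compactin_Union) auto
  moreover have "(\<Union>\<beta>\<in>B. (\<lambda>s. branch_map \<beta> (x, s)) ` {0..2}) \<subseteq> tree x"
    unfolding tree_eq[OF x] by (intro UN_mono B(3) order_refl)
  with \<U> have "(\<Union>\<beta>\<in>B. (\<lambda>s. branch_map \<beta> (x, s)) ` {0..2}) \<subseteq> \<Union> \<U>"
    by (meson order_trans)
  ultimately obtain \<F> where \<F>: "finite \<F>" "\<F> \<subseteq> \<U>"
      "(\<Union>\<beta>\<in>B. (\<lambda>s. branch_map \<beta> (x, s)) ` {0..2}) \<subseteq> \<Union> \<F>"
    using \<U> unfolding compactin_def by meson
  have "tree x \<subseteq> \<Union> (insert U0 \<F>)"
  proof
    fix y assume y: "y \<in> tree x"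
    then obtain \<beta> s where \<beta>: "\<beta> \<in> A" "0 \<le> s" "s \<le> w \<beta> x" "y = move \<beta> s (e x)"
      by (auto simp: tree_def)
    show "y \<in> \<Union> (insert U0 \<F>)"
    proof (cases "\<beta> \<in> B")
      case True
      then have "y \<in> (\<Union>\<beta>\<in>B. (\<lambda>s. branch_map \<beta> (x, s)) ` {0..2})"
        using \<beta> branch_eq[OF \<beta>(1) x] by (intro UN_I[of \<beta>]) auto
      then show ?thesis
        using \<F>(3) by blast
    next
      case False
      then have "hedgehog_dist (e x) y < \<epsilon>"
        using dist_branch[OF x \<beta>(2,3)] B(1,4) \<beta> \<epsilon>(1) by fastforce
      then have "y \<in> U0"
        using \<epsilon>(2) tree_subset[OF x] y by blast
      then show ?thesis by blast
    qed
  qed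
  then show "\<exists>\<F>. finite \<F> \<and> \<F> \<subseteq> \<U> \<and> tree x \<subseteq> \<Union> \<F>"
    using \<F>(1,2) U0(1) by (intro exI[of _ "insert U0 \<F>"]) auto
qed

text \<open>For each branch, the points whose branch meets \<open>U\<close> form the projection of
  an open subset of the product, and projections are open.\<close>

lemma lsc_tree: "lsc_map X (hedgehog A) tree"
  unfolding lsc_map_def
proof (intro allI impI)
  fix U assume U: "openin (hedgehog A) U"
  let ?Z = "prod_topology X (top_of_set {0..2::real})"
  have "openin X (fst ` {p \<in> topspace ?Z. branch_map \<beta> p \<in> U})" if "\<beta> \<in> A" for \<beta>
    using open_map_fst openin_continuous_map_preimage[OF continuous_branch_map[OF that] U]
    unfolding open_map_def by blast
  then have "openin X (\<Union>\<beta>\<in>A. fst ` {p \<in> topspace ?Z. branch_map \<beta> p \<in> U})"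
    by blast
  moreover have "{x \<in> topspace X. tree x \<inter> U \<noteq> {}}
      = (\<Union>\<beta>\<in>A. fst ` {p \<in> topspace ?Z. branch_map \<beta> p \<in> U})"
    by (force simp: tree_eq image_iff)
  ultimately show "openin X {x \<in> topspace X. tree x \<inter> U \<noteq> {}}"
    by simp
qed

text \<open>For one branch, the set \<open>H \<beta>\<close> of points whose branch meets
  \<open>F\<close> is closed, being a projection along the compact interval \<open>{0..2}\<close>.
  For the infinite union one argues locally: near a point whose tree misses \<open>F\<close>, short
  branches stay in a ball about the root that misses \<open>F\<close>, and only finitely many
  \<open>H \<beta>\<close> have to be avoided.\<close>

lemma usc_tree: "usc_map X (hedgehog A) tree"
  unfolding usc_map_def
proof (intro allI impI)
  fix F assume F: "closedin (hedgehog A) F"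
  let ?Z = "prod_topology X (top_of_set {0..2::real})"
  define H where "H = (\<lambda>\<beta>. fst ` {p \<in> topspace ?Z. branch_map \<beta> p \<in> F})"
  have H: "closedin X (H \<beta>)" if "\<beta> \<in> A" for \<beta>
  proof -
    have "closed_map ?Z X fst"
      by (rule Abstract_Topological_Spaces.closed_map_fst) (simp add: compact_space_subtopology)
    then show ?thesis
      using closedin_continuous_map_preimage[OF continuous_branch_map[OF that] F]
      unfolding closed_map_def H_def by blast
  qed
  have iff: "tree x \<inter> F \<noteq> {} \<longleftrightarrow> (\<exists>\<beta>\<in>A. x \<in> H \<beta>)" if "x \<in> topspace X" for x
    using that by (force simp: tree_eq image_iff H_def)
  have "\<exists>W. openin X W \<and> x \<in> W \<and> W \<subseteq> topspace X - {x \<in> topspace X. tree x \<inter> F \<noteq> {}}"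
    if x: "x \<in> topspace X" "tree x \<inter> F = {}" for x
  proof -
    have "e x \<in> hedgehog_points A - F"
      using x e_in e_in_tree by blast
    moreover have "openin (hedgehog A) (hedgehog_points A - F)"
      using F by (metis closedin_def topspace_hedgehog)
    ultimately obtain \<epsilon> where \<epsilon>: "0 < \<epsilon>"
      "\<And>z. z \<in> hedgehog_points A \<Longrightarrow> hedgehog_dist (e x) z < \<epsilon> \<Longrightarrow> z \<notin> F"
      using openin_hedgehog_dist by (metis DiffD2)
    obtain U where U: "openin X U" "x \<in> U" "\<And>z. z \<in> U \<Longrightarrow> hedgehog_dist (e x) (e z) < \<epsilon> / 2"
      using continuous_e x(1) \<epsilon>(1) unfolding continuous_map_into_hedgehog by (meson half_gt_zero)
    obtain V B where V: "openin X V" "x \<in> V" "finite B" "B \<subseteq> A"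
        "\<And>z \<beta>. z \<in> V \<Longrightarrow> \<beta> \<in> A - B \<Longrightarrow> w \<beta> z \<le> \<epsilon> / 2"
      using finite_long_branches[OF x(1), of "\<epsilon> / 2"] \<epsilon>(1) by (metis half_gt_zero)
    \<comment> \<open>\<open>U\<close> controls the motion of the root and \<open>V\<close> the
      short branches, each up to \<open>\<epsilon> / 2\<close>; the long branches are handled by
      deleting their closed sets.\<close>
    define W where "W = U \<inter> V - (\<Union>\<beta>\<in>B. H \<beta>)"
    have "openin X W"
      unfolding W_def using U V H by (intro openin_diff openin_Int closedin_Union) auto
    moreover have "x \<in> W"
      using U V iff[OF x(1)] x(2) by (auto simp: W_def)
    moreover have "tree z \<inter> F = {}" if z: "z \<in> W" for z
    proof -
      have zX: "z \<in> topspace X" "z \<in> U" "z \<in> V"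
        using z U(1) openin_subset by (auto simp: W_def)
      have "y \<notin> F" if y: "y \<in> tree z" for y
      proof -
        obtain \<beta> s where \<beta>: "\<beta> \<in> A" "0 \<le> s" "s \<le> w \<beta> z" "y = move \<beta> s (e z)"
          using y by (auto simp: tree_def)
        show ?thesis
        proof (cases "\<beta> \<in> B")
          case True
          obtain t where "t \<in> {0..2}" "y = branch_map \<beta> (z, t)"
            using branch_eq[OF \<beta>(1) zX(1)] \<beta> by (metis (no_types, lifting) atLeastAtMost_iff image_iff)
          moreover have "z \<notin> H \<beta>"
            using z True by (auto simp: W_def)
          ultimately show ?thesis
            using zX(1) by (force simp: H_def image_iff)
        next
          case False
          have "hedgehog_dist (e x) y \<le> hedgehog_dist (e x) (e z) + hedgehog_dist (e z) y"
            using Metric_space.triangle[OF Metric_space_hedgehog] e_in x(1) zX(1) tree_subset y by blast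
          also have "\<dots> < \<epsilon> / 2 + \<epsilon> / 2"
            using False \<beta> U(3)[OF zX(2)] dist_branch[OF zX(1) \<beta>(2,3) V(5)[OF zX(3)]]
            by (intro add_less_le_mono) auto
          finally show ?thesis
            using \<epsilon>(2) tree_subset[OF zX(1)] y by auto
        qed
      qed
      then show ?thesis by blast
    qed
    ultimately show ?thesis
      using openin_subset by (intro exI[of _ W]) blast
  qed
  then have "openin X (topspace X - {x \<in> topspace X. tree x \<inter> F \<noteq> {}})"
    by (subst openin_subopen) blast
  then show "closedin X {x \<in> topspace X. tree x \<inter> F \<noteq> {}}"
    by (auto simp: closedin_def)
qed

lemma tree_compact_connected: "tree \<in> topspace X \<rightarrow> compact_connected_sets (hedgehog A)"
  using compactin_tree connectedin_tree e_in_tree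
  by (auto simp: compact_connected_sets_def compact_sets_def)

lemma continuous_tree: "continuous_set_map X (hedgehog A) tree"
  by (simp add: continuous_set_map_def lsc_tree usc_tree)

end

section \<open>Expanding indexed families\<close>

lemma locally_finite_family_subset:
  assumes "locally_finite_family X I U" "\<And>i. i \<in> I \<Longrightarrow> W i \<subseteq> U i"
  shows "locally_finite_family X I W"
  unfolding locally_finite_family_def
proof (intro conjI ballI)
  show "W i \<subseteq> topspace X" if "i \<in> I" for i
    using assms that by (auto simp: locally_finite_family_def)
  fix x assume "x \<in> topspace X"
  then obtain V where V: "openin X V" "x \<in> V" "finite {i \<in> I. U i \<inter> V \<noteq> {}}"
    using assms(1) by (auto simp: locally_finite_family_def)
  have "{i \<in> I. W i \<inter> V \<noteq> {}} \<subseteq> {i \<in> I. U i \<inter> V \<noteq> {}}"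
    using assms(2) by blast
  with V show "\<exists>V. openin X V \<and> x \<in> V \<and> finite {i \<in> I. W i \<inter> V \<noteq> {}}"
    by (meson finite_subset)
qed

lemma locally_finite_family_UN:
  assumes N: "finite N" and U: "\<And>n. n \<in> N \<Longrightarrow> locally_finite_family X I (U n)"
  shows "locally_finite_family X I (\<lambda>i. \<Union>n\<in>N. U n i)"
  unfolding locally_finite_family_def
proof (intro conjI ballI)
  show "(\<Union>n\<in>N. U n i) \<subseteq> topspace X" if "i \<in> I" for i
    using U that by (auto simp: locally_finite_family_def)
  fix x assume x: "x \<in> topspace X"
  then have "\<forall>n\<in>N. \<exists>V. openin X V \<and> x \<in> V \<and> finite {i \<in> I. U n i \<inter> V \<noteq> {}}"
    using U by (auto simp: locally_finite_family_def)
  then obtain V where V: "\<And>n. n \<in> N \<Longrightarrow> openin X (V n)" "\<And>n. n \<in> N \<Longrightarrow> x \<in> V n"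
      "\<And>n. n \<in> N \<Longrightarrow> finite {i \<in> I. U n i \<inter> V n \<noteq> {}}"
    by metis
  \<comment> \<open>The factor \<open>topspace X\<close> keeps the neighbourhood inside the space
    when \<open>N\<close> is empty.\<close>
  have "{i \<in> I. (\<Union>n\<in>N. U n i) \<inter> ((\<Inter>n\<in>N. V n) \<inter> topspace X) \<noteq> {}}
      \<subseteq> (\<Union>n\<in>N. {i \<in> I. U n i \<inter> V n \<noteq> {}})"
    by auto
  moreover have "finite (\<Union>n\<in>N. {i \<in> I. U n i \<inter> V n \<noteq> {}})"
    using N V(3) by blast
  moreover have "openin X ((\<Inter>n\<in>N. V n) \<inter> topspace X)"
    using N V(1) by (rule openin_INT)
  ultimately show "\<exists>V. openin X V \<and> x \<in> V \<and> finite {i \<in> I. (\<Union>n\<in>N. U n i) \<inter> V \<noteq> {}}"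
    using V(2) x by (intro exI[of _ "(\<Inter>n\<in>N. V n) \<inter> topspace X"]) (auto intro: finite_subset)
qed

text \<open>\<open>expandable\<close> speaks of sets of closed sets, whereas an indexed family may
  repeat a member. Local finiteness allows a nonempty set to be repeated only finitely often, so an
  expansion of the image can be pulled back along \<open>F\<close>.\<close>

lemma expandable_indexed:
  assumes X: "expandable \<tau> X" and A: "|A| \<le>o \<tau>"
    and clo: "\<And>\<alpha>. \<alpha> \<in> A \<Longrightarrow> closedin X (F \<alpha>)" and lf: "locally_finite_family X A F"
  obtains U where "\<And>\<alpha>. \<alpha> \<in> A \<Longrightarrow> openin X (U \<alpha>)" "\<And>\<alpha>. \<alpha> \<in> A \<Longrightarrow> F \<alpha> \<subseteq> U \<alpha>"
    "locally_finite_family X A U"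
proof -
  have "locally_finite_in X (F ` A)"
    unfolding locally_finite_in_def
  proof (intro conjI ballI)
    show "\<Union> (F ` A) \<subseteq> topspace X"
      using lf by (auto simp: locally_finite_family_def)
    fix x assume "x \<in> topspace X"
    then obtain V where V: "openin X V" "x \<in> V" "finite {\<alpha> \<in> A. F \<alpha> \<inter> V \<noteq> {}}"
      using lf by (auto simp: locally_finite_family_def)
    have "{S \<in> F ` A. S \<inter> V \<noteq> {}} \<subseteq> F ` {\<alpha> \<in> A. F \<alpha> \<inter> V \<noteq> {}}"
      by auto
    with V show "\<exists>V. openin X V \<and> x \<in> V \<and> finite {S \<in> F ` A. S \<inter> V \<noteq> {}}"
      by (meson finite_imageI finite_subset)
  qed
  moreover have "|F ` A| \<le>o \<tau>"
    using card_of_image A by (rule ordLeq_transitive)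
  ultimately obtain U' where U': "\<And>\<alpha>. \<alpha> \<in> A \<Longrightarrow> openin X (U' (F \<alpha>)) \<and> F \<alpha> \<subseteq> U' (F \<alpha>)"
      and lfU': "locally_finite_family X (F ` A) U'"
    using X clo unfolding expandable_def by (metis (no_types, lifting) imageE imageI)
  \<comment> \<open>The empty set may occur infinitely often while \<open>U' {}\<close> is nonempty,
    so it is expanded by itself.\<close>
  define U where "U = (\<lambda>\<alpha>. if F \<alpha> = {} then {} else U' (F \<alpha>))"
  show thesis
  proof
    show "openin X (U \<alpha>)" "F \<alpha> \<subseteq> U \<alpha>" if "\<alpha> \<in> A" for \<alpha>
      using U'[OF that] by (auto simp: U_def)
    show "locally_finite_family X A U"
      unfolding locally_finite_family_def
    proof (intro conjI ballI)
      show "U \<alpha> \<subseteq> topspace X" if "\<alpha> \<in> A" for \<alpha>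
        using U'[OF that] openin_subset by (auto simp: U_def)
      fix x assume "x \<in> topspace X"
      then obtain V where V: "openin X V" "x \<in> V" "finite {S \<in> F ` A. U' S \<inter> V \<noteq> {}}"
        using lfU' by (auto simp: locally_finite_family_def)
      have "finite {\<alpha> \<in> A. F \<alpha> = S \<and> S \<noteq> {}}" if "S \<in> F ` A" for S
      proof (cases "S = {}")
        case False
        then obtain z where z: "z \<in> S" by blast
        then have "z \<in> topspace X"
          using lf that by (auto simp: locally_finite_family_def)
        then obtain V' where V': "z \<in> V'" "finite {\<alpha> \<in> A. F \<alpha> \<inter> V' \<noteq> {}}"
          using lf by (auto simp: locally_finite_family_def)
        have "{\<alpha> \<in> A. F \<alpha> = S \<and> S \<noteq> {}} \<subseteq> {\<alpha> \<in> A. F \<alpha> \<inter> V' \<noteq> {}}"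
          using z V'(1) by auto
        then show ?thesis
          using V'(2) by (rule finite_subset)
      qed simp
      then have "finite (\<Union>S\<in>{S \<in> F ` A. U' S \<inter> V \<noteq> {}}. {\<alpha> \<in> A. F \<alpha> = S \<and> S \<noteq> {}})"
        using V(3) by blast
      moreover have "{\<alpha> \<in> A. U \<alpha> \<inter> V \<noteq> {}}
          \<subseteq> (\<Union>S\<in>{S \<in> F ` A. U' S \<inter> V \<noteq> {}}. {\<alpha> \<in> A. F \<alpha> = S \<and> S \<noteq> {}})"
        by (auto simp: U_def)
      ultimately show "\<exists>V. openin X V \<and> x \<in> V \<and> finite {\<alpha> \<in> A. U \<alpha> \<inter> V \<noteq> {}}"
        using V by (meson finite_subset)
    qed
  qed
qed

section \<open>Lower semicontinuous majorants with locally finite level sets\<close>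

lemma ex_dyadic_between:
  fixes t :: real
  assumes "0 < t" "t \<le> 1"
  obtains n where "(1/2) ^ Suc n \<le> t" "t \<le> (1/2) ^ n"
proof -
  define n where "n = (LEAST n. (1/2) ^ Suc n \<le> t)"
  have "\<exists>n. (1/2) ^ Suc n \<le> t"
  proof -
    obtain n where "(1/2) ^ n < t"
      using real_arch_pow_inv[OF assms(1), of "1/2"] by auto
    moreover have "(1/2 :: real) ^ Suc n \<le> (1/2) ^ n"
      by (intro power_decreasing) auto
    ultimately show ?thesis by (intro exI[of _ n]) linarith
  qed
  then have n: "(1/2) ^ Suc n \<le> t"
    unfolding n_def by (rule LeastI_ex)
  have "t \<le> (1/2) ^ n"
  proof (cases n)
    case (Suc k)
    then have "k < n" by simp
    then have "\<not> (1/2) ^ Suc k \<le> t"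
      unfolding n_def by (rule not_less_Least)
    with Suc show ?thesis by simp
  qed (use assms in simp)
  with n show thesis by (rule that)
qed

text \<open>Expand, for each \<open>n\<close>, the sets where \<open>\<theta>\<close> reaches a
  dyadic height, and let \<open>u\<close> be the supremum of the resulting step functions. Only
  finitely many steps exceed a given \<open>\<epsilon>\<close>, so the set where
  \<open>u > \<epsilon>\<close> lies in a finite union of expansions.\<close>

lemma locally_finite_majorant:
  assumes X: "expandable \<tau> X" and A: "|A| \<le>o \<tau>"
    and \<theta>: "usc_map X (hedgehog A) \<theta>" and c\<theta>: "\<theta> \<in> topspace X \<rightarrow> compact_sets (hedgehog A)"
  obtains u :: "'i \<Rightarrow> 'a \<Rightarrow> real" where
    "\<And>\<alpha>. \<alpha> \<in> A \<Longrightarrow> lower_semicontinuous X (u \<alpha>)" "\<And>\<alpha> x. 0 \<le> u \<alpha> x"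
    "\<And>\<alpha> x y. \<lbrakk>\<alpha> \<in> A; x \<in> topspace X; y \<in> \<theta> x\<rbrakk> \<Longrightarrow> coord {\<alpha>} y \<le> u \<alpha> x"
    "\<And>\<epsilon>. 0 < \<epsilon> \<Longrightarrow> locally_finite_family X A (\<lambda>\<alpha>. {x \<in> topspace X. \<epsilon> < u \<alpha> x})"
proof -
  have \<theta>A: "\<theta> x \<subseteq> hedgehog_points A" if "x \<in> topspace X" for x
    using c\<theta> compactin_subset_topspace that by (fastforce simp: compact_sets_def topspace_hedgehog)
  \<comment> \<open>The threshold \<open>(1/2) ^ Suc n\<close> is half the value
    \<open>(1/2) ^ n\<close> given to \<open>v\<close> on the expansion, so a height in this dyadic
    interval is dominated by \<open>v\<close>.\<close>
  define F where "F = (\<lambda>n \<alpha>. {x \<in> topspace X. \<exists>y\<in>\<theta> x. (1/2) ^ Suc n \<le> coord {\<alpha>} y})"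
  have cF: "closedin X (F n \<alpha>)" for n \<alpha>
  proof -
    have eq: "F n \<alpha> = {x \<in> topspace X. \<theta> x \<inter> {y \<in> hedgehog_points A. (1/2) ^ Suc n \<le> coord {\<alpha>} y} \<noteq> {}}"
      using \<theta>A by (auto simp: F_def)
    show ?thesis
      unfolding eq by (rule \<theta>[unfolded usc_map_def, rule_format, OF closedin_coord_ge])
  qed
  have lF: "locally_finite_family X A (F n)" for n
    unfolding F_def by (rule locally_finite_spines[OF \<theta> c\<theta>]) simp
  have "\<exists>U. (\<forall>\<alpha>\<in>A. openin X (U \<alpha>) \<and> F n \<alpha> \<subseteq> U \<alpha>) \<and> locally_finite_family X A U" for n
    by (rule expandable_indexed[OF X A cF lF[of n]]) blast
  then obtain U where U: "\<And>n \<alpha>. \<alpha> \<in> A \<Longrightarrow> openin X (U n \<alpha>)" "\<And>n \<alpha>. \<alpha> \<in> A \<Longrightarrow> F n \<alpha> \<subseteq> U n \<alpha>"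
      "\<And>n. locally_finite_family X A (U n)"
    by metis
  define v where "v = (\<lambda>\<alpha> x n. if x \<in> U n \<alpha> then (1/2 :: real) ^ n else 0)"
  define u where "u = (\<lambda>\<alpha> x. SUP n. v \<alpha> x n)"
  have v01: "0 \<le> v \<alpha> x n" "v \<alpha> x n \<le> 1" for \<alpha> x n
    by (auto simp: v_def power_le_one)
  have bdd: "bdd_above (range (v \<alpha> x))" for \<alpha> x
    using v01(2) by (intro bdd_aboveI[of _ 1]) auto
  have less_u: "c < u \<alpha> x \<longleftrightarrow> (\<exists>n. c < v \<alpha> x n)" for c \<alpha> x
    unfolding u_def by (subst less_cSUP_iff[OF _ bdd]) auto
  have v_le_u: "v \<alpha> x n \<le> u \<alpha> x" for \<alpha> x n
    unfolding u_def by (rule cSUP_upper[OF _ bdd]) simp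
  show thesis
  proof
    show "lower_semicontinuous X (u \<alpha>)" if \<alpha>: "\<alpha> \<in> A" for \<alpha>
      unfolding lower_semicontinuous_def
    proof
      fix c
      have "openin X {x \<in> topspace X. c < v \<alpha> x n}" for n
      proof -
        have "{x \<in> topspace X. c < v \<alpha> x n} =
            (if c < 0 then topspace X else if c < (1/2) ^ n then U n \<alpha> else {})"
          using openin_subset[OF U(1)[OF \<alpha>, of n]] v01(1)[of \<alpha> _ n]
          by (auto simp: v_def intro: less_le_trans)
        then show ?thesis
          using U(1)[OF \<alpha>] by simp
      qed
      moreover have "{x \<in> topspace X. c < u \<alpha> x} = (\<Union>n. {x \<in> topspace X. c < v \<alpha> x n})"
        by (auto simp: less_u)
      ultimately show "openin X {x \<in> topspace X. c < u \<alpha> x}"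
        by auto
    qed
    show "0 \<le> u \<alpha> x" for \<alpha> x
      using v01(1) v_le_u by (rule order_trans)
    show "coord {\<alpha>} y \<le> u \<alpha> x" if "\<alpha> \<in> A" "x \<in> topspace X" "y \<in> \<theta> x" for \<alpha> x y
    proof (cases "0 < coord {\<alpha>} y")
      case True
      moreover have "coord {\<alpha>} y \<le> 1"
        using abs_coord_le_1[of y A "{\<alpha>}"] \<theta>A that by force
      ultimately obtain n where n: "(1/2) ^ Suc n \<le> coord {\<alpha>} y" "coord {\<alpha>} y \<le> (1/2) ^ n"
        by (rule ex_dyadic_between)
      then have "x \<in> U n \<alpha>"
        using U(2)[OF that(1), of n] that by (auto simp: F_def)
      then show ?thesis
        using n(2) v_le_u[of \<alpha> x n] by (simp add: v_def)
    next
      case False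
      then show ?thesis
        using v01(1)[of \<alpha> x 0] v_le_u[of \<alpha> x 0] by linarith
    qed
    fix \<epsilon> :: real assume "0 < \<epsilon>"
    then obtain N where N: "(1/2) ^ N < \<epsilon>"
      using real_arch_pow_inv[of \<epsilon> "1/2"] by auto
    have sub: "{x \<in> topspace X. \<epsilon> < u \<alpha> x} \<subseteq> (\<Union>n\<in>{..<N}. U n \<alpha>)" for \<alpha>
    proof
      fix x assume "x \<in> {x \<in> topspace X. \<epsilon> < u \<alpha> x}"
      then obtain n where n: "\<epsilon> < v \<alpha> x n"
        using less_u by auto
      then have "x \<in> U n \<alpha>" "\<epsilon> < (1/2) ^ n"
        using \<open>0 < \<epsilon>\<close> by (auto simp: v_def split: if_splits)
      moreover have "n < N"
      proof (rule ccontr)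
        assume "\<not> n < N"
        then have "(1/2 :: real) ^ n \<le> (1/2) ^ N"
          by (intro power_decreasing) auto
        with \<open>\<epsilon> < (1/2) ^ n\<close> N show False by linarith
      qed
      ultimately show "x \<in> (\<Union>n\<in>{..<N}. U n \<alpha>)"
        by blast
    qed
    show "locally_finite_family X A (\<lambda>\<alpha>. {x \<in> topspace X. \<epsilon> < u \<alpha> x})"
      by (rule locally_finite_family_subset[OF locally_finite_family_UN[OF finite_lessThan U(3)] sub])
  qed
qed

section \<open>The root of the tree\<close>

text \<open>
  The conclusion says that \<open>e x\<close> lies on the segment from the origin to each point of \<open>\<theta> x\<close>.
  The distance of \<open>e x\<close> to the origin is inserted between that of \<open>\<Phi> x\<close> and that of the smallest
  subtree containing \<open>\<theta> x\<close>.
\<close>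

lemma continuous_root:
  fixes X :: "'a topology" and A :: "'i set"
  assumes X: "normal_space X"
    and c\<Phi>: "\<Phi> \<in> topspace X \<rightarrow> compact_connected_sets' (hedgehog A)" and \<Phi>: "lsc_map X (hedgehog A) \<Phi>"
    and c\<theta>: "\<theta> \<in> topspace X \<rightarrow> compact_sets (hedgehog A)" and \<theta>: "usc_map X (hedgehog A) \<theta>"
    and le: "selection_le X \<theta> \<Phi>" and A: "A \<noteq> {}"
  obtains e where "continuous_map X (hedgehog A) e" "\<And>x. x \<in> topspace X \<Longrightarrow> e x \<in> \<Phi> x"
    "\<And>x y. \<lbrakk>x \<in> topspace X; y \<in> \<theta> x\<rbrakk> \<Longrightarrow>
      \<exists>\<alpha>\<in>A. \<exists>m c. e x = spine_point \<alpha> m \<and> y = spine_point \<alpha> c \<and> 0 \<le> m \<and> m \<le> c"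
proof -
  have \<Phi>A: "\<Phi> x \<noteq> {} \<and> \<Phi> x \<subseteq> hedgehog_points A" if "x \<in> topspace X" for x
    using c\<Phi> that compact_connected_sets'_subset by blast
  have \<theta>A: "\<theta> x \<noteq> {} \<and> \<theta> x \<subseteq> hedgehog_points A" if "x \<in> topspace X" for x
    using c\<theta> that compactin_subset_topspace by (fastforce simp: compact_sets_def topspace_hedgehog)
  have \<theta>\<Phi>: "\<theta> x \<subseteq> \<Phi> x" if "x \<in> topspace X" for x
    using le that by (auto simp: selection_le_def)
  have convex: "spinewise_convex (\<Phi> x)" if "x \<in> topspace X" for x
    using c\<Phi> that spinewise_convex_compact_connected' by blast
  define d where "d = (\<lambda>x. INF y\<in>\<Phi> x. coord UNIV y)"
  \<comment> \<open>If \<open>\<theta> x\<close> lies on one open spine, the smallest subtree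
    containing it starts at the infimum of the heights; otherwise that subtree contains the origin.
    Hence the two cases of \<open>\<mu>\<close>.\<close>
  define on_spine where "on_spine = (\<lambda>x \<alpha>. \<alpha> \<in> A \<and> (\<forall>y\<in>\<theta> x. 0 < coord {\<alpha>} y))"
  define \<mu> where "\<mu> = (\<lambda>x. if \<exists>\<alpha>. on_spine x \<alpha> then INF y\<in>\<theta> x. coord UNIV y else 0)"
  define W where "W = (\<lambda>\<alpha> c. {x \<in> topspace X. \<theta> x \<subseteq> {y \<in> hedgehog_points A. c < coord {\<alpha>} y}})"
  have W: "openin X (W \<alpha> c)" for \<alpha> c
    unfolding W_def using \<theta>A by (intro usc_map_openin[OF \<theta>] openin_coord_gt) (simp add: topspace_hedgehog)
  have coord_eq: "coord UNIV y = coord {\<alpha>} y" if "0 < coord {\<alpha>} y" "y \<in> hedgehog_points A" for y \<alpha>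
    using that by (cases y) (auto split: if_splits)
  have unique: "\<alpha> = \<beta>" if sp: "on_spine x \<alpha>" "on_spine x \<beta>" and x: "x \<in> topspace X" for x \<alpha> \<beta>
  proof -
    obtain y where y: "y \<in> \<theta> x" using \<theta>A[OF x] by blast
    then have "0 < coord {\<alpha>} y" "0 < coord {\<beta>} y" "y \<in> hedgehog_points A"
      using sp \<theta>A[OF x] by (auto simp: on_spine_def)
    then show ?thesis
      by (cases y) (auto split: if_splits)
  qed
  have bdd: "bdd_below (coord UNIV ` K)" if "K \<subseteq> hedgehog_points A" for K
    using bdd_coord(2)[OF that] .
  have d: "upper_semicontinuous X d"
    unfolding d_def
    by (rule upper_semicontinuous_INF[OF \<Phi> continuous_map_coord])
      (use \<Phi>A bdd in \<open>auto simp: topspace_hedgehog\<close>)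
  have d0: "0 \<le> d x" if "x \<in> topspace X" for x
    unfolding d_def using \<Phi>A[OF that] coord_UNIV_nonneg by (intro cINF_greatest) auto
  have d1: "d x \<le> 1" if x: "x \<in> topspace X" for x
  proof -
    obtain y where y: "y \<in> \<Phi> x" using \<Phi>A[OF x] by blast
    have "d x \<le> coord UNIV y"
      unfolding d_def using \<Phi>A[OF x] by (intro cINF_lower bdd y) auto
    also have "\<dots> \<le> 1"
      using abs_coord_le_1[of y A UNIV] \<Phi>A[OF x] y by auto
    finally show ?thesis .
  qed
  have \<mu>0: "0 \<le> \<mu> x" if "x \<in> topspace X" for x
    unfolding \<mu>_def using \<theta>A[OF that] coord_UNIV_nonneg by (auto intro!: cINF_greatest)
  have \<mu>_posD: "\<exists>\<alpha>. on_spine x \<alpha> \<and> \<mu> x = (INF y\<in>\<theta> x. coord UNIV y)" if "0 < \<mu> x" for x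
    using that by (auto simp: \<mu>_def split: if_splits)
  have \<mu>: "lower_semicontinuous X \<mu>"
    unfolding lower_semicontinuous_def
  proof
    fix c
    show "openin X {x \<in> topspace X. c < \<mu> x}"
    proof (cases "c < 0")
      case True
      then have "{x \<in> topspace X. c < \<mu> x} = topspace X"
        using \<mu>0 by (auto intro: less_le_trans)
      then show ?thesis by simp
    next
      case False
      \<comment> \<open>For \<open>c \<ge> 0\<close>, \<open>\<mu> x > c\<close> means that
        \<open>\<theta> x\<close> lies on one spine above some level \<open>b > c\<close>, and this
        is open by upper semi-continuity.\<close>
      have "{x \<in> topspace X. c < \<mu> x} = (\<Union>\<alpha>\<in>A. \<Union>b\<in>{c<..}. W \<alpha> b)"
      proof (intro equalityI subsetI)
        fix x assume "x \<in> {x \<in> topspace X. c < \<mu> x}"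
        then have x: "x \<in> topspace X" "c < \<mu> x" by auto
        then obtain \<alpha> where \<alpha>: "on_spine x \<alpha>" and \<mu>x: "\<mu> x = (INF y\<in>\<theta> x. coord UNIV y)"
          using False \<mu>_posD[of x] by fastforce
        obtain b where b: "c < b" "b < \<mu> x" using dense x(2) by blast
        have "b < coord {\<alpha>} y" if y: "y \<in> \<theta> x" for y
        proof -
          have "\<mu> x \<le> coord UNIV y"
            unfolding \<mu>x using \<theta>A[OF x(1)] by (intro cINF_lower bdd y) auto
          also have "\<dots> = coord {\<alpha>} y"
            using \<alpha> y \<theta>A[OF x(1)] by (intro coord_eq) (auto simp: on_spine_def)
          finally show ?thesis using b(2) by simp
        qed
        then show "x \<in> (\<Union>\<alpha>\<in>A. \<Union>b\<in>{c<..}. W \<alpha> b)"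
          using x(1) b(1) \<alpha> \<theta>A[OF x(1)] by (intro UN_I[of \<alpha>] UN_I[of b]) (auto simp: W_def on_spine_def)
      next
        fix x assume "x \<in> (\<Union>\<alpha>\<in>A. \<Union>b\<in>{c<..}. W \<alpha> b)"
        then obtain \<alpha> b where b: "\<alpha> \<in> A" "c < b" and x: "x \<in> topspace X"
            and y: "\<And>y. y \<in> \<theta> x \<Longrightarrow> y \<in> hedgehog_points A \<and> b < coord {\<alpha>} y"
          by (auto simp: W_def)
        have "on_spine x \<alpha>"
          using b y False by (force simp: on_spine_def)
        then have "\<mu> x = (INF y\<in>\<theta> x. coord UNIV y)"
          by (auto simp: \<mu>_def)
        moreover have "b \<le> (INF y\<in>\<theta> x. coord UNIV y)"
        proof (rule cINF_greatest)
          show "b \<le> coord UNIV z" if "z \<in> \<theta> x" for z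
            using y[OF that] coord_le_coord_UNIV[of z A "{\<alpha>}"] by linarith
        qed (use \<theta>A[OF x] in blast)
        ultimately show "x \<in> {x \<in> topspace X. c < \<mu> x}"
          using b(2) x by auto
      qed
      also have "openin X \<dots>"
        by (intro openin_Union ballI) (auto intro!: openin_Union W)
      finally show ?thesis .
    qed
  qed
  \<comment> \<open>On one spine this follows from \<open>\<theta> x \<subseteq> \<Phi> x\<close>.
    Otherwise spinewise convexity puts the origin into \<open>\<Phi> x\<close>, so
    \<open>d x \<le> 0\<close>.\<close>
  have "d x \<le> \<mu> x" if x: "x \<in> topspace X" for x
  proof (cases "\<exists>\<alpha>. on_spine x \<alpha>")
    case True
    then show ?thesis
      unfolding d_def \<mu>_def using \<theta>A[OF x] \<Phi>A[OF x] \<theta>\<Phi>[OF x] bdd by (auto intro!: cINF_superset_mono)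
  next
    case False
    obtain y0 where y0: "y0 \<in> \<theta> x" using \<theta>A[OF x] by blast
    have "Origin \<in> \<Phi> x"
    proof (cases y0)
      case Origin
      then show ?thesis using y0 \<theta>\<Phi>[OF x] by blast
    next
      case (Spine s \<alpha>)
      then have s: "\<alpha> \<in> A" "0 < s" using y0 \<theta>A[OF x] by auto
      then obtain y1 where y1: "y1 \<in> \<theta> x" "coord {\<alpha>} y1 \<le> 0"
        using False by (force simp: on_spine_def)
      have "spine_point \<alpha> 0 \<in> \<Phi> x"
        using y0 y1 \<theta>\<Phi>[OF x] s Spine by (intro spinewise_convexD[OF convex[OF x], of y1 y0]) auto
      then show ?thesis by (simp add: spine_point_def)
    qed
    then have "d x \<le> coord UNIV (Origin :: 'i hedgehog_point)"
      unfolding d_def using \<Phi>A[OF x] by (intro cINF_lower bdd) auto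
    then show ?thesis using \<mu>0[OF x] by simp
  qed
  then obtain m where m: "continuous_map X euclideanreal m"
      "\<And>x. x \<in> topspace X \<Longrightarrow> d x \<le> m x" "\<And>x. x \<in> topspace X \<Longrightarrow> m x \<le> \<mu> x"
    using Katetov_Tong_insertion[OF X d \<mu> _ d1 \<mu>0] by metis
  have m0: "0 \<le> m x" if "x \<in> topspace X" for x
    using d0[OF that] m(2)[OF that] by simp
  \<comment> \<open>For \<open>m x > 0\<close> the spine is the one carrying
    \<open>\<theta> x\<close>; for \<open>m x = 0\<close> every choice gives
    \<open>e x = Origin\<close>.\<close>
  define sp where "sp = (\<lambda>x. if 0 < m x then SOME \<alpha>. on_spine x \<alpha> else SOME \<alpha>. \<alpha> \<in> A)"
  define e where "e = (\<lambda>x. spine_point (sp x) (m x))"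
  have on_sp: "on_spine x (sp x)" "\<And>y. y \<in> \<theta> x \<Longrightarrow> m x \<le> coord {sp x} y"
    if x: "x \<in> topspace X" "0 < m x" for x
  proof -
    have "0 < \<mu> x" using x(2) m(3)[OF x(1)] by simp
    then obtain \<alpha> where \<alpha>: "on_spine x \<alpha>" and \<mu>x: "\<mu> x = (INF y\<in>\<theta> x. coord UNIV y)"
      using \<mu>_posD by blast
    show sp: "on_spine x (sp x)"
      using \<alpha> x(2) someI[of "on_spine x" \<alpha>] by (simp add: sp_def)
    fix y assume y: "y \<in> \<theta> x"
    have "m x \<le> \<mu> x" by (rule m(3)[OF x(1)])
    also have "\<dots> \<le> coord UNIV y"
      unfolding \<mu>x using \<theta>A[OF x(1)] by (intro cINF_lower bdd y) auto
    also have "\<dots> = coord {sp x} y"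
      using sp y \<theta>A[OF x(1)] by (intro coord_eq) (auto simp: on_spine_def)
    finally show "m x \<le> coord {sp x} y" .
  qed
  have segment: "\<exists>\<alpha>\<in>A. \<exists>m c. e x = spine_point \<alpha> m \<and> y = spine_point \<alpha> c \<and> 0 \<le> m \<and> m \<le> c"
    if x: "x \<in> topspace X" and y: "y \<in> \<theta> x" for x y
  proof (cases "0 < m x")
    case True
    have "m x \<le> coord {sp x} y" "sp x \<in> A"
      using on_sp[OF x True] y by (auto simp: on_spine_def)
    moreover from this have "y = spine_point (sp x) (coord {sp x} y)"
      using \<theta>A[OF x] y True by (intro coord_eq_imp_spine_point[of y A]) auto
    ultimately show ?thesis
      using True by (force simp: e_def)
  next
    case False
    then have ex: "e x = Origin"
      using m0[OF x] by (simp add: e_def spine_point_def)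
    show ?thesis
    proof (cases y)
      case Origin
      then show ?thesis
        using ex A by (auto intro!: exI[of _ 0] simp: spine_point_def)
    next
      case (Spine s \<alpha>)
      then have "0 < s" "\<alpha> \<in> A" using \<theta>A[OF x] y by auto
      then show ?thesis
        using ex Spine by (intro bexI[of _ \<alpha>] exI[of _ 0] exI[of _ s]) (auto simp: spine_point_def)
    qed
  qed
  \<comment> \<open>On the spine of the root, \<open>m x\<close> lies between the coordinate of a
    point of \<open>\<Phi> x\<close> nearest to the origin and that of a point of
    \<open>\<theta> x\<close>.\<close>
  have e\<Phi>: "e x \<in> \<Phi> x" if x: "x \<in> topspace X" for x
  proof -
    obtain y where y: "y \<in> \<theta> x" using \<theta>A[OF x] by blast
    obtain z where z: "z \<in> \<Phi> x" "coord UNIV z = d x"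
      using coord_attains_INF c\<Phi> x unfolding d_def by blast
    have zA: "z \<in> hedgehog_points A" using z \<Phi>A[OF x] by auto
    show ?thesis
    proof (cases "0 < m x")
      case True
      have "coord {sp x} z \<le> m x"
        using coord_le_coord_UNIV[OF zA, of "{sp x}"] z(2) m(2)[OF x] by simp
      then show ?thesis
        unfolding e_def using z y True on_sp(2)[OF x True y] \<theta>\<Phi>[OF x]
        by (intro spinewise_convexD[OF convex[OF x], of z y]) auto
    next
      case False
      then have "coord UNIV z \<le> 0"
        using m(2)[OF x] z(2) by simp
      then have "z = Origin"
        using zA by (cases z) auto
      then show ?thesis
        using z(1) False m0[OF x] by (simp add: e_def spine_point_def)
    qed
  qed
  have "continuous_map X (hedgehog A) e"
    unfolding continuous_map_into_hedgehog
  proof (intro conjI ballI allI impI)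
    show "e \<in> topspace X \<rightarrow> hedgehog_points A"
      using e\<Phi> \<Phi>A by blast
    fix x and \<epsilon> :: real assume x: "x \<in> topspace X" and \<epsilon>: "0 < \<epsilon>"
    have mo: "openin X {z \<in> topspace X. c < m z}" "openin X {z \<in> topspace X. m z < c}" for c
      using m(1) by (auto simp: continuous_map_upper_lower_semicontinuous_lt)
    show "\<exists>U. openin X U \<and> x \<in> U \<and> (\<forall>z\<in>U. hedgehog_dist (e x) (e z) < \<epsilon>)"
    proof (cases "0 < m x")
      case False
      then have "m x = 0" using m0[OF x] by simp
      then show ?thesis
        using x \<epsilon> mo(2)[of \<epsilon>] m0
        by (intro exI[of _ "{z \<in> topspace X. m z < \<epsilon>}"]) (auto simp: e_def spine_point_def)
    next
      case True
      \<comment> \<open>On \<open>W (sp x) 0\<close> the set \<open>\<theta> z\<close> stays on the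
        spine \<open>sp x\<close>, so the chosen spine is locally constant and only the continuous
        height \<open>m\<close> varies.\<close>
      define U where "U = W (sp x) 0 \<inter> {z \<in> topspace X. m x - \<epsilon> < m z}
          \<inter> {z \<in> topspace X. m z < m x + \<epsilon>} \<inter> {z \<in> topspace X. 0 < m z}"
      have "openin X U"
        unfolding U_def by (intro openin_Int W mo)
      moreover have "x \<in> U"
        using x \<epsilon> True on_sp(1)[OF x True] \<theta>A[OF x] by (auto simp: U_def W_def on_spine_def)
      moreover have "hedgehog_dist (e x) (e z) < \<epsilon>" if z: "z \<in> U" for z
      proof -
        have zX: "z \<in> topspace X" "0 < m z" and "on_spine z (sp x)"
          using z on_sp(1)[OF x True] by (auto simp: U_def W_def on_spine_def)
        then have "sp z = sp x"
          using unique on_sp(1) by blast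
        moreover have "\<bar>m x - m z\<bar> < \<epsilon>"
          using z unfolding U_def by (simp add: abs_less_iff)
        ultimately show ?thesis
          using True zX(2) by (simp add: e_def spine_point_def)
      qed
      ultimately show ?thesis by blast
    qed
  qed
  then show thesis
    using e\<Phi> segment by (rule that)
qed

section \<open>The selection theorem\<close>

text \<open>Along each spine, a continuous endpoint \<open>r \<beta>\<close> is inserted between
  what the branch must reach and what it may reach; the tree with branch lengths
  \<open>r \<beta> x - coord {\<beta>} (e x)\<close> is the selection.\<close>

lemma continuous_selection_hedgehog:
  fixes X :: "'a topology" and A :: "'i set"
  assumes X: "normal_space X" and expand: "expandable \<tau> X" and A\<tau>: "|A| \<le>o \<tau>" and A: "A \<noteq> {}"
    and c\<Phi>: "\<Phi> \<in> topspace X \<rightarrow> compact_connected_sets' (hedgehog A)" and \<Phi>: "lsc_map X (hedgehog A) \<Phi>"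
    and c\<theta>: "\<theta> \<in> topspace X \<rightarrow> compact_sets (hedgehog A)" and \<theta>: "usc_map X (hedgehog A) \<theta>"
    and le: "selection_le X \<theta> \<Phi>"
  shows "\<exists>\<phi>. \<phi> \<in> topspace X \<rightarrow> compact_connected_sets (hedgehog A) \<and>
    continuous_set_map X (hedgehog A) \<phi> \<and> selection_le X \<theta> \<phi> \<and> selection_le X \<phi> \<Phi>"
proof -
  have \<Phi>A: "\<Phi> x \<noteq> {} \<and> \<Phi> x \<subseteq> hedgehog_points A" if "x \<in> topspace X" for x
    using c\<Phi> that compact_connected_sets'_subset by blast
  have \<theta>A: "\<theta> x \<noteq> {} \<and> \<theta> x \<subseteq> hedgehog_points A" if "x \<in> topspace X" for x
    using c\<theta> that compactin_subset_topspace by (fastforce simp: compact_sets_def topspace_hedgehog)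
  have \<theta>\<Phi>: "\<theta> x \<subseteq> \<Phi> x" if "x \<in> topspace X" for x
    using le that by (auto simp: selection_le_def)
  obtain e where e: "continuous_map X (hedgehog A) e" "\<And>x. x \<in> topspace X \<Longrightarrow> e x \<in> \<Phi> x"
    and segment: "\<And>x y. \<lbrakk>x \<in> topspace X; y \<in> \<theta> x\<rbrakk> \<Longrightarrow>
      \<exists>\<alpha>\<in>A. \<exists>m c. e x = spine_point \<alpha> m \<and> y = spine_point \<alpha> c \<and> 0 \<le> m \<and> m \<le> c"
    using continuous_root[OF X c\<Phi> \<Phi> c\<theta> \<theta> le A] by metis
  obtain u :: "'i \<Rightarrow> 'a \<Rightarrow> real" where
    u: "\<And>\<beta>. \<beta> \<in> A \<Longrightarrow> lower_semicontinuous X (u \<beta>)" "\<And>\<beta> x. 0 \<le> u \<beta> x"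
    "\<And>\<beta> x y. \<lbrakk>\<beta> \<in> A; x \<in> topspace X; y \<in> \<theta> x\<rbrakk> \<Longrightarrow> coord {\<beta>} y \<le> u \<beta> x"
    "\<And>\<epsilon>. 0 < \<epsilon> \<Longrightarrow> locally_finite_family X A (\<lambda>\<beta>. {x \<in> topspace X. \<epsilon> < u \<beta> x})"
    by (fact locally_finite_majorant[OF expand A\<tau> \<theta> c\<theta>])
  have eA: "e x \<in> hedgehog_points A" if "x \<in> topspace X" for x
    using e(2)[OF that] \<Phi>A[OF that] by blast
  define T where "T = (\<lambda>\<beta> x. SUP y\<in>\<Phi> x. coord {\<beta>} y)"
  define t where "t = (\<lambda>\<beta> x. SUP y\<in>\<theta> x. coord {\<beta>} y)"
  have le_T: "coord {\<beta>} y \<le> T \<beta> x" if "x \<in> topspace X" "y \<in> \<Phi> x" for \<beta> x y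
    unfolding T_def using \<Phi>A[OF that(1)] by (intro cSUP_upper that bdd_coord) auto
  have le_t: "coord {\<beta>} y \<le> t \<beta> x" if "x \<in> topspace X" "y \<in> \<theta> x" for \<beta> x y
    unfolding t_def using \<theta>A[OF that(1)] by (intro cSUP_upper that bdd_coord) auto
  have t_le: "t \<beta> x \<le> c" if "x \<in> topspace X" "\<And>y. y \<in> \<theta> x \<Longrightarrow> coord {\<beta>} y \<le> c" for \<beta> x c
    unfolding t_def using \<theta>A[OF that(1)] that(2) by (intro cSUP_least) auto
  have T1: "T \<beta> x \<le> 1" if "x \<in> topspace X" for \<beta> x
  proof -
    have "coord {\<beta>} y \<le> 1" if "y \<in> \<Phi> x" for y
      using abs_coord_le_1[of y A "{\<beta>}"] \<Phi>A[OF \<open>x \<in> topspace X\<close>] that by (auto simp: abs_le_iff)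
    then show ?thesis
      unfolding T_def using \<Phi>A[OF that] by (intro cSUP_least) auto
  qed
  \<comment> \<open>The lower bounds make the length nonnegative and let the branch reach
    \<open>\<theta> x\<close>; the upper bounds keep it in \<open>\<Phi> x\<close> and its length
    below \<open>u\<close>, which yields local finiteness.\<close>
  have "\<exists>r. continuous_map X euclideanreal r \<and>
      (\<forall>x \<in> topspace X. max (coord {\<beta>} (e x)) (t \<beta> x) \<le> r x \<and>
        r x \<le> min (T \<beta> x) (coord {\<beta>} (e x) + u \<beta> x))" if \<beta>: "\<beta> \<in> A" for \<beta>
  proof -
    have D: "continuous_map X euclideanreal (\<lambda>x. coord {\<beta>} (e x))"
      using continuous_map_compose[OF e(1) continuous_map_coord] by (simp add: o_def)
    have "lower_semicontinuous X (T \<beta>)"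
      unfolding T_def by (rule lower_semicontinuous_SUP[OF \<Phi> continuous_map_coord])
        (use \<Phi>A bdd_coord(1)[OF order_refl] in \<open>auto simp: topspace_hedgehog\<close>)
    then have lsc: "lower_semicontinuous X (\<lambda>x. min (T \<beta> x) (coord {\<beta>} (e x) + u \<beta> x))"
      by (intro lower_semicontinuous_min lower_semicontinuous_add
          continuous_map_imp_lower_semicontinuous[OF D] u(1) \<beta>)
    have "upper_semicontinuous X (t \<beta>)"
      unfolding t_def by (rule upper_semicontinuous_SUP[OF \<theta> continuous_map_coord])
        (use \<theta>A bdd_coord(1)[OF order_refl] in \<open>auto simp: topspace_hedgehog\<close>)
    then have usc: "upper_semicontinuous X (\<lambda>x. max (coord {\<beta>} (e x)) (t \<beta> x))"
      by (intro upper_semicontinuous_max continuous_map_imp_upper_semicontinuous[OF D])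
    have le: "max (coord {\<beta>} (e x)) (t \<beta> x) \<le> min (T \<beta> x) (coord {\<beta>} (e x) + u \<beta> x)"
      if x: "x \<in> topspace X" for x
    proof -
      \<comment> \<open>By \<open>segment\<close>, \<open>y\<close> lies beyond \<open>e x\<close>
        on a common spine \<open>\<alpha>\<close>. If \<open>\<alpha> = \<beta>\<close>, the root
        has a nonnegative coordinate and \<open>u\<close> dominates that of \<open>y\<close>;
        otherwise \<open>-c \<le> -m\<close> suffices.\<close>
      have "coord {\<beta>} y \<le> coord {\<beta>} (e x) + u \<beta> x" if y: "y \<in> \<theta> x" for y
      proof -
        obtain \<alpha> m c where "e x = spine_point \<alpha> m" "y = spine_point \<alpha> c" "0 \<le> m" "m \<le> c"
          using segment[OF x y] by blast
        then show ?thesis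
          using u(2)[of \<beta> x] u(3)[OF \<beta> x y] by (cases "\<alpha> = \<beta>") auto
      qed
      then have "t \<beta> x \<le> coord {\<beta>} (e x) + u \<beta> x"
        by (rule t_le[OF x])
      moreover have "t \<beta> x \<le> T \<beta> x"
        using \<theta>\<Phi>[OF x] by (intro t_le[OF x] le_T[OF x]) auto
      ultimately show ?thesis
        using le_T[OF x e(2)[OF x], of \<beta>] u(2)[of \<beta> x] by simp
    qed
    have upper: "max (coord {\<beta>} (e x)) (t \<beta> x) \<le> 1" if "x \<in> topspace X" for x
      using le[OF that] T1[OF that, of \<beta>] by linarith
    have lower: "-1 \<le> min (T \<beta> x) (coord {\<beta>} (e x) + u \<beta> x)" if "x \<in> topspace X" for x
      using le[OF that] abs_coord_le_1[OF eA[OF that], of "{\<beta>}"] by linarith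
    show ?thesis
      by (rule Katetov_Tong_insertion[OF X usc lsc le upper lower]) blast+
  qed
  then have "\<exists>r. \<forall>\<beta>\<in>A. continuous_map X euclideanreal (r \<beta>) \<and>
      (\<forall>x \<in> topspace X. max (coord {\<beta>} (e x)) (t \<beta> x) \<le> r \<beta> x \<and>
        r \<beta> x \<le> min (T \<beta> x) (coord {\<beta>} (e x) + u \<beta> x))"
    by (intro bchoice ballI)
  then obtain r where r: "\<And>\<beta>. \<beta> \<in> A \<Longrightarrow> continuous_map X euclideanreal (r \<beta>)"
    "\<And>\<beta> x. \<lbrakk>\<beta> \<in> A; x \<in> topspace X\<rbrakk> \<Longrightarrow> coord {\<beta>} (e x) \<le> r \<beta> x \<and> t \<beta> x \<le> r \<beta> x \<and>
        r \<beta> x \<le> T \<beta> x \<and> r \<beta> x \<le> coord {\<beta>} (e x) + u \<beta> x"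
    by auto
  define w where "w = (\<lambda>\<beta> x. r \<beta> x - coord {\<beta>} (e x))"
  interpret hedgehog_branches X A e w
  proof
    show "A \<noteq> {}" "continuous_map X (hedgehog A) e" by fact+
    show "continuous_map X euclideanreal (w \<beta>)" if "\<beta> \<in> A" for \<beta>
      unfolding w_def using continuous_map_compose[OF e(1) continuous_map_coord[of A "{\<beta>}"]] r(1)[OF that]
      by (intro continuous_map_diff) (simp_all add: o_def)
    show "0 \<le> w \<beta> x" "coord {\<beta>} (e x) + w \<beta> x \<le> 1" if "\<beta> \<in> A" "x \<in> topspace X" for \<beta> x
      using r(2)[OF that] T1[OF that(2), of \<beta>] by (auto simp: w_def)
    show "locally_finite_family X A (\<lambda>\<beta>. {x \<in> topspace X. \<epsilon> < w \<beta> x})" if "0 < \<epsilon>" for \<epsilon>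
      by (rule locally_finite_family_subset[OF u(4)[OF that]]) (use r(2) in \<open>force simp: w_def\<close>)
  qed
  have "\<theta> x \<subseteq> tree x" if x: "x \<in> topspace X" for x
  proof
    fix y assume y: "y \<in> \<theta> x"
    then obtain \<alpha> m c where \<alpha>: "\<alpha> \<in> A" and ey: "e x = spine_point \<alpha> m" "y = spine_point \<alpha> c"
        and mc: "0 \<le> m" "m \<le> c"
      using segment[OF x] by blast
    \<comment> \<open>Growing from height \<open>m\<close> to \<open>c\<close> on the spine
      \<open>\<alpha>\<close> needs length \<open>c - m\<close>, and
      \<open>c \<le> t \<alpha> x \<le> r \<alpha> x\<close>.\<close>
    have "c - m \<in> {0..w \<alpha> x}"
      using mc ey r(2)[OF \<alpha> x] le_t[OF x y, of \<alpha>] by (simp add: w_def)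
    moreover have "y = move \<alpha> (c - m) (e x)"
      unfolding ey by (rule move_to_spine_point[OF mc, symmetric])
    ultimately show "y \<in> tree x"
      unfolding tree_def using \<alpha> by blast
  qed
  moreover have "tree x \<subseteq> \<Phi> x" if x: "x \<in> topspace X" for x
  proof
    fix y assume "y \<in> tree x"
    then obtain \<beta> s where \<beta>: "\<beta> \<in> A" and s: "0 \<le> s" "s \<le> w \<beta> x" and y: "y = move \<beta> s (e x)"
      by (auto simp: tree_def)
    have \<Phi>x: "\<Phi> x \<in> compact_connected_sets' (hedgehog A)"
      using c\<Phi> x by blast
    obtain z where z: "z \<in> \<Phi> x" "coord {\<beta>} z = T \<beta> x"
      using coord_attains_SUP[OF \<Phi>x \<beta>] unfolding T_def by blast
    show "y \<in> \<Phi> x"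
      unfolding y
    proof (rule move_in_spinewise_convex)
      show "spinewise_convex (\<Phi> x)"
        by (rule spinewise_convex_compact_connected'[OF \<Phi>x])
      show "\<Phi> x \<subseteq> hedgehog_points A" "e x \<in> \<Phi> x" "z \<in> \<Phi> x" "0 \<le> s"
        using \<Phi>A[OF x] e(2)[OF x] z(1) s(1) by auto
      show "coord {\<beta>} (e x) + s \<le> coord {\<beta>} z"
        using s(2) z(2) r(2)[OF \<beta> x] by (simp add: w_def)
    qed
  qed
  ultimately show ?thesis
    using tree_compact_connected continuous_tree by (auto simp: selection_le_def intro!: exI[of _ tree])
qed

section \<open>Necessity of normality and expandability\<close>

locale hedgehog_selections =
  fixes X :: "'a topology" and A :: "'i set"
  assumes selection: "\<lbrakk>\<Phi> \<in> topspace X \<rightarrow> compact_connected_sets' (hedgehog A); lsc_map X (hedgehog A) \<Phi>;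
      \<theta> \<in> topspace X \<rightarrow> compact_sets (hedgehog A); usc_map X (hedgehog A) \<theta>; selection_le X \<theta> \<Phi>\<rbrakk> \<Longrightarrow>
    \<exists>\<phi>. \<phi> \<in> topspace X \<rightarrow> compact_connected_sets (hedgehog A) \<and>
      continuous_set_map X (hedgehog A) \<phi> \<and> selection_le X \<theta> \<phi> \<and> selection_le X \<phi> \<Phi>"
begin

lemma normal:
  assumes A: "A \<noteq> {}"
  shows "normal_space X"
  unfolding normal_space_alt
proof (intro allI impI)
  fix S U assume SU: "closedin X S \<and> openin X U \<and> S \<subseteq> U"
  obtain \<alpha> where \<alpha>: "\<alpha> \<in> A" using A by blast
  define K where "K = spine_point \<alpha> ` {0..1}"
  \<comment> \<open>The closed spine is traced by \<open>move\<close> from the constant root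
    \<open>Origin\<close>.\<close>
  have "continuous_map (top_of_set {0..1}) (hedgehog A) (\<lambda>s. move \<alpha> (id s) Origin)"
    by (rule continuous_map_move) (use \<alpha> in \<open>auto simp: topspace_hedgehog\<close>)
  then have cs: "continuous_map (top_of_set {0..1}) (hedgehog A) (spine_point \<alpha>)"
    by simp
  have K: "compactin (hedgehog A) K" "connectedin (hedgehog A) K"
    unfolding K_def
    by (rule image_compactin[OF _ cs] connectedin_continuous_map_image[OF cs],
        simp add: compactin_subtopology connectedin_subtopology)+
  have OK: "Origin \<in> K" "Spine 1 \<alpha> \<in> K"
    by (force simp: K_def spine_point_def image_iff)+
  define \<Phi> where "\<Phi> = (\<lambda>x. if x \<in> U then K else {Origin})"
  define \<theta> where "\<theta> = (\<lambda>x. if x \<in> S then {Origin, Spine 1 \<alpha>} else {Origin})"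
  have "\<exists>\<phi>. \<phi> \<in> topspace X \<rightarrow> compact_connected_sets (hedgehog A) \<and>
      continuous_set_map X (hedgehog A) \<phi> \<and> selection_le X \<theta> \<phi> \<and> selection_le X \<phi> \<Phi>"
  proof (rule selection)
    show "\<Phi> \<in> topspace X \<rightarrow> compact_connected_sets' (hedgehog A)"
      using K OK by (auto simp: \<Phi>_def compact_connected_sets'_def compact_connected_sets_def
          compact_sets_def topspace_hedgehog split: if_splits)
    show "\<theta> \<in> topspace X \<rightarrow> compact_sets (hedgehog A)"
      using \<alpha> by (auto simp: \<theta>_def compact_sets_def topspace_hedgehog intro!: finite_imp_compactin split: if_splits)
    show "lsc_map X (hedgehog A) \<Phi>"
      unfolding lsc_map_def
    proof (intro allI impI)
      fix V
      \<comment> \<open>\<open>Origin\<close> belongs to every value, so the preimage can be proper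
        only if \<open>V\<close> misses it, and then it is \<open>U\<close> or empty.\<close>
      have "{x \<in> topspace X. \<Phi> x \<inter> V \<noteq> {}} =
          (if Origin \<in> V then topspace X else if K \<inter> V \<noteq> {} then U else {})"
        using OK openin_subset SU by (auto simp: \<Phi>_def)
      then show "openin X {x \<in> topspace X. \<Phi> x \<inter> V \<noteq> {}}"
        using SU by simp
    qed
    show "usc_map X (hedgehog A) \<theta>"
      unfolding usc_map_def
    proof (intro allI impI)
      fix F
      have "{x \<in> topspace X. \<theta> x \<inter> F \<noteq> {}} =
          (if Origin \<in> F then topspace X else if Spine 1 \<alpha> \<in> F then S else {})"
        using closedin_subset SU by (auto simp: \<theta>_def)
      then show "closedin X {x \<in> topspace X. \<theta> x \<inter> F \<noteq> {}}"
        using SU by simp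
    qed
    show "selection_le X \<theta> \<Phi>"
      using SU OK by (auto simp: selection_le_def \<theta>_def \<Phi>_def)
  qed
  then obtain \<phi> where \<phi>: "lsc_map X (hedgehog A) \<phi>" "usc_map X (hedgehog A) \<phi>"
      "\<And>x. x \<in> topspace X \<Longrightarrow> \<theta> x \<subseteq> \<phi> x" "\<And>x. x \<in> topspace X \<Longrightarrow> \<phi> x \<subseteq> \<Phi> x"
    unfolding continuous_set_map_def selection_le_def by blast
  \<comment> \<open>Then \<open>S \<subseteq> V \<subseteq> E \<subseteq> U\<close> with
    \<open>V\<close> open by lower and \<open>E\<close> closed by upper semi-continuity, so the
    closure of \<open>V\<close> stays in \<open>U\<close>.\<close>
  define V where "V = {x \<in> topspace X. \<phi> x \<inter> {y \<in> hedgehog_points A. 1/2 < coord {\<alpha>} y} \<noteq> {}}"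
  define E where "E = {x \<in> topspace X. \<phi> x \<inter> {y \<in> hedgehog_points A. 1/2 \<le> coord {\<alpha>} y} \<noteq> {}}"
  have "openin X V"
    unfolding V_def by (rule \<phi>(1)[unfolded lsc_map_def, rule_format, OF openin_coord_gt])
  moreover have "closedin X E"
    unfolding E_def by (rule \<phi>(2)[unfolded usc_map_def, rule_format, OF closedin_coord_ge])
  moreover have "V \<subseteq> E"
    by (force simp: V_def E_def)
  moreover have "E \<subseteq> U"
  proof
    fix x assume "x \<in> E"
    then obtain y where y: "x \<in> topspace X" "y \<in> \<phi> x" "1/2 \<le> coord {\<alpha>} y"
      by (auto simp: E_def)
    then have "y \<in> \<Phi> x" "y \<noteq> Origin"
      using \<phi>(4) by auto
    then show "x \<in> U"
      by (auto simp: \<Phi>_def split: if_splits)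
  qed
  moreover have "S \<subseteq> V"
  proof
    fix x assume x: "x \<in> S"
    then have xX: "x \<in> topspace X" using SU closedin_subset by blast
    have "Spine 1 \<alpha> \<in> \<phi> x"
      using \<phi>(3)[OF xX] x by (auto simp: \<theta>_def)
    moreover have "Spine 1 \<alpha> \<in> {y \<in> hedgehog_points A. 1/2 < coord {\<alpha>} y}"
      using \<alpha> by simp
    ultimately show "x \<in> V"
      using xX unfolding V_def by blast
  qed
  ultimately show "\<exists>V. openin X V \<and> S \<subseteq> V \<and> X closure_of V \<subseteq> U"
    by (meson closure_of_minimal order_trans)
qed

text \<open>An injection \<open>\<iota>\<close> gives each member of the family its own spine.
  \<open>\<Phi>\<close> is constantly the whole hedgehog, an admissible value even if not compact;
  local finiteness of the expansion comes from the compact values of \<open>\<phi>\<close>.\<close>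

lemma expandable:
  assumes \<tau>: "\<tau> \<le>o |A|"
  shows "expandable \<tau> X"
  unfolding expandable_def
proof (intro allI impI)
  fix \<F> :: "'a set set"
  assume "(\<forall>F\<in>\<F>. closedin X F) \<and> locally_finite_in X \<F> \<and> |\<F>| \<le>o \<tau>"
  then have clo: "\<And>F. F \<in> \<F> \<Longrightarrow> closedin X F" and lf: "locally_finite_in X \<F>" and "|\<F>| \<le>o |A|"
    using \<tau> ordLeq_transitive by auto
  then obtain \<iota> where \<iota>: "inj_on \<iota> \<F>" "\<iota> ` \<F> \<subseteq> A"
    by (metis card_of_ordLeq)
  define \<theta> where "\<theta> = (\<lambda>x. insert Origin ((\<lambda>F. Spine 1 (\<iota> F)) ` {F \<in> \<F>. x \<in> F}))"
  have "\<exists>\<phi>. \<phi> \<in> topspace X \<rightarrow> compact_connected_sets (hedgehog A) \<and>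
      continuous_set_map X (hedgehog A) \<phi> \<and> selection_le X \<theta> \<phi> \<and>
      selection_le X \<phi> (\<lambda>x. hedgehog_points A)"
  proof (rule selection)
    show "(\<lambda>x. hedgehog_points A) \<in> topspace X \<rightarrow> compact_connected_sets' (hedgehog A)"
      by (simp add: compact_connected_sets'_def topspace_hedgehog)
    show "lsc_map X (hedgehog A) (\<lambda>x. hedgehog_points A)"
      unfolding lsc_map_def
    proof (intro allI impI)
      fix U
      have "{x \<in> topspace X. hedgehog_points A \<inter> U \<noteq> {}}
          = (if hedgehog_points A \<inter> U = {} then {} else topspace X)"
        by auto
      then show "openin X {x \<in> topspace X. hedgehog_points A \<inter> U \<noteq> {}}"
        by simp
    qed
    have "finite {F \<in> \<F>. x \<in> F}" if x: "x \<in> topspace X" for x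
    proof -
      obtain V where V: "x \<in> V" "finite {F \<in> \<F>. F \<inter> V \<noteq> {}}"
        using lf x by (auto simp: locally_finite_in_def)
      have "{F \<in> \<F>. x \<in> F} \<subseteq> {F \<in> \<F>. F \<inter> V \<noteq> {}}"
        using V(1) by blast
      then show ?thesis
        using V(2) by (rule finite_subset)
    qed
    then show "\<theta> \<in> topspace X \<rightarrow> compact_sets (hedgehog A)"
      using \<iota>(2) by (auto simp: \<theta>_def compact_sets_def topspace_hedgehog intro!: finite_imp_compactin)
    show "selection_le X \<theta> (\<lambda>x. hedgehog_points A)"
      using \<iota>(2) by (auto simp: selection_le_def \<theta>_def)
    show "usc_map X (hedgehog A) \<theta>"
      unfolding usc_map_def
    proof (intro allI impI)
      fix G
      show "closedin X {x \<in> topspace X. \<theta> x \<inter> G \<noteq> {}}"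
      proof (cases "Origin \<in> G")
        case True
        then have "{x \<in> topspace X. \<theta> x \<inter> G \<noteq> {}} = topspace X"
          by (auto simp: \<theta>_def)
        then show ?thesis by simp
      next
        case False
        \<comment> \<open>If \<open>G\<close> misses the origin, its preimage is a union of members
          of a locally finite closed family.\<close>
        then have "{x \<in> topspace X. \<theta> x \<inter> G \<noteq> {}} = \<Union> {F \<in> \<F>. Spine 1 (\<iota> F) \<in> G}"
          using closedin_subset[OF clo] by (auto simp: \<theta>_def)
        moreover have "closedin X (\<Union> {F \<in> \<F>. Spine 1 (\<iota> F) \<in> G})"
          by (rule closedin_locally_finite_Union[OF _ locally_finite_in_subset[OF lf]]) (auto intro: clo)
        ultimately show ?thesis by simp
      qed
    qed
  qed
  then obtain \<phi> where c\<phi>: "\<phi> \<in> topspace X \<rightarrow> compact_connected_sets (hedgehog A)"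
      and \<phi>: "lsc_map X (hedgehog A) \<phi>" "usc_map X (hedgehog A) \<phi>" "\<And>x. x \<in> topspace X \<Longrightarrow> \<theta> x \<subseteq> \<phi> x"
    unfolding continuous_set_map_def selection_le_def by blast
  \<comment> \<open>Upper semi-continuity makes the sets \<open>W \<alpha>\<close> locally finite,
    lower semi-continuity makes the smaller sets \<open>U F\<close> open.\<close>
  define W where "W = (\<lambda>\<alpha>. {x \<in> topspace X. \<exists>y\<in>\<phi> x. 1/2 \<le> coord {\<alpha>} y})"
  define U where "U = (\<lambda>F. {x \<in> topspace X. \<phi> x \<inter> {y \<in> hedgehog_points A. 1/2 < coord {\<iota> F} y} \<noteq> {}})"
  have W: "locally_finite_family X A W"
    unfolding W_def using c\<phi>
    by (intro locally_finite_spines[OF \<phi>(2)]) (auto simp: compact_connected_sets_def)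
  have UW: "U F \<subseteq> W (\<iota> F)" for F
    by (force simp: U_def W_def)
  show "\<exists>U. (\<forall>F\<in>\<F>. openin X (U F) \<and> F \<subseteq> U F) \<and> locally_finite_family X \<F> U"
  proof (intro exI[of _ U] conjI ballI)
    fix F assume F: "F \<in> \<F>"
    show "openin X (U F)"
      unfolding U_def by (rule \<phi>(1)[unfolded lsc_map_def, rule_format, OF openin_coord_gt])
    show "F \<subseteq> U F"
    proof
      fix x assume x: "x \<in> F"
      then have xX: "x \<in> topspace X" using clo[OF F] closedin_subset by blast
      have "Spine 1 (\<iota> F) \<in> \<phi> x"
        using \<phi>(3)[OF xX] x F by (auto simp: \<theta>_def)
      moreover have "Spine 1 (\<iota> F) \<in> {y \<in> hedgehog_points A. 1/2 < coord {\<iota> F} y}"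
        using \<iota>(2) F by auto
      ultimately show "x \<in> U F"
        using xX unfolding U_def by blast
    qed
  next
    show "locally_finite_family X \<F> U"
      unfolding locally_finite_family_def
    proof (intro conjI ballI)
      show "U F \<subseteq> topspace X" for F
        by (auto simp: U_def)
      fix x assume "x \<in> topspace X"
      then obtain V where V: "openin X V" "x \<in> V" "finite {\<alpha> \<in> A. W \<alpha> \<inter> V \<noteq> {}}"
        using W by (auto simp: locally_finite_family_def)
      have "\<iota> ` {F \<in> \<F>. U F \<inter> V \<noteq> {}} \<subseteq> {\<alpha> \<in> A. W \<alpha> \<inter> V \<noteq> {}}"
        using UW \<iota>(2) by blast
      then have "finite (\<iota> ` {F \<in> \<F>. U F \<inter> V \<noteq> {}})"
        using V(3) by (rule finite_subset)
      moreover have "inj_on \<iota> {F \<in> \<F>. U F \<inter> V \<noteq> {}}"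
        using \<iota>(1) by (rule inj_on_subset) blast
      ultimately have "finite {F \<in> \<F>. U F \<inter> V \<noteq> {}}"
        by (rule finite_imageD)
      with V(1,2) show "\<exists>V. openin X V \<and> x \<in> V \<and> finite {F \<in> \<F>. U F \<inter> V \<noteq> {}}"
        by blast
    qed
  qed
qed

end

theorem theorem1p2:
  fixes \<tau> :: "'k rel" and A :: "'i set" and X :: "'a topology"
  assumes "Cinfinite \<tau>" and "|A| =o \<tau>"
    and "Hausdorff_space X" and "infinite (topspace X)"
  shows "(normal_space X \<and> expandable \<tau> X) \<longleftrightarrow>
    (\<forall>\<Phi> \<theta>.
       \<Phi> \<in> topspace X \<rightarrow> compact_connected_sets' (hedgehog A) \<and> lsc_map X (hedgehog A) \<Phi> \<and>
       \<theta> \<in> topspace X \<rightarrow> compact_sets (hedgehog A) \<and> usc_map X (hedgehog A) \<theta> \<and>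
       selection_le X \<theta> \<Phi> \<longrightarrow>
       (\<exists>\<phi>. \<phi> \<in> topspace X \<rightarrow> compact_connected_sets (hedgehog A) \<and>
            continuous_set_map X (hedgehog A) \<phi> \<and>
            selection_le X \<theta> \<phi> \<and> selection_le X \<phi> \<Phi>))"
    (is "?lhs \<longleftrightarrow> ?rhs")
proof
  have "cinfinite |A|"
    using assms(1,2) cinfinite_mono ordIso_symmetric ordIso_imp_ordLeq by blast
  then have A: "A \<noteq> {}"
    by (auto simp: cinfinite_def Field_card_of)
  \<comment> \<open>The first inequality allows expanding families indexed by the spines, the second
    provides enough spines for a given family.\<close>
  have A\<tau>: "|A| \<le>o \<tau>" "\<tau> \<le>o |A|"
    using assms(2) by (auto simp: ordIso_iff_ordLeq)
  show ?rhs if ?lhs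
    using that continuous_selection_hedgehog[OF _ _ A\<tau>(1) A] by blast
  show ?lhs if ?rhs
  proof -
    interpret hedgehog_selections X A
      using that by unfold_locales blast
    show ?thesis
      using normal[OF A] expandable[OF A\<tau>(2)] by simp
  qed
qed

end
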